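(* Let $G$ be a finite abelian group. Then there exist positive integers $n$ and $d$ such that $G\cong U_n^{(d)}$.
   Context: For a positive integer $n$, $U_n$ denotes the multiplicative group of reduced residues modulo $n$, that is, the integers $a$ with $1\le a\le n$ and $\gcd(a,n)=1$ under multiplication modulo $n$ (equivalently, the unit group $(\mathbb{Z}/n\mathbb{Z})^\times$). For a positive integer $d$, $U_n^{(d)}=\{a^d : a\in U_n\}$ denotes the subgroup of $d$-th powers in $U_n$. *)

theory Defs
  imports "HOL-Algebra.Group" "HOL-Number_Theory.Totient"
begin

text \<open>
  \<open>U n\<close> is carried by the representatives \<open>1 \<le> a \<le> n\<close> coprime to \<open>n\<close>. Products are
  represented by \<open>a * b mod n\<close>, except for \<open>n = 1\<close>, where the only residue class is
  represented by \<open>1\<close> and not by \<open>0\<close>.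
\<close>

definition U :: "nat \<Rightarrow> nat monoid" where
  "U n = \<lparr>carrier = totatives n,
          monoid.mult = (\<lambda>a b. if n = 1 then 1 else a * b mod n),
          one = 1\<rparr>"

definition U_pow :: "nat \<Rightarrow> nat \<Rightarrow> nat monoid" where
  "U_pow n d = (U n)\<lparr>carrier := {a [^]\<^bsub>U n\<^esub> d | a. a \<in> carrier (U n)}\<rparr>"

lemma comm_group_U:
  assumes "n > 0"
  shows "comm_group (U n)"
proof (cases "n = 1")
  case True
  then have "totatives n = {1}" by simp
  then show ?thesis
    by (intro comm_groupI) (auto simp: U_def True)
next
  case False
  with assms have n: "n > 1" by simp
  have lt: "a < n" if "a \<in> totatives n" for a
    using that n totatives_less by blast
  have closed: "a * b mod n \<in> totatives n" if "a \<in> totatives n" "b \<in> totatives n" for a b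
  proof -
    have cop: "coprime (a * b mod n) n"
      using that n by (simp add: in_totatives_iff coprime_mod_left_iff)
    then have "a * b mod n > 0"
      using n by (intro gr0I) auto
    then show ?thesis
      using cop n by (simp add: in_totatives_iff less_imp_le)
  qed
  have inv: "\<exists>b\<in>totatives n. b * a mod n = Suc 0" if "a \<in> totatives n" for a
  proof -
    have "coprime a n" using that by (simp add: in_totatives_iff)
    then obtain x where "[a * x = Suc 0] (mod n)"
      using cong_solve_coprime_nat by blast
    then have x: "(x mod n) * a mod n = Suc 0"
      using n by (simp add: cong_def mod_mult_right_eq mult.commute)
    then have "coprime ((x mod n) * a mod n) n"
      by simp
    then have "coprime (x mod n) n"
      using n by (simp add: coprime_mod_left_iff)
    moreover from x have "x mod n > 0"
      by (intro gr0I) auto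
    ultimately show ?thesis
      using x n by (intro bexI[of _ "x mod n"]) (auto simp: in_totatives_iff less_imp_le)
  qed
  show ?thesis
    using n lt closed inv
    by (intro comm_groupI) (auto simp: U_def mod_mult_left_eq mod_mult_right_eq ac_simps)
qed

lemma subgroup_U_pow:
  assumes "n > 0"
  shows "subgroup (carrier (U_pow n d)) (U n)"
proof -
  interpret comm_group "U n" using assms by (rule comm_group_U)
  have c: "carrier (U_pow n d) = (\<lambda>a. a [^]\<^bsub>U n\<^esub> d) ` carrier (U n)"
    by (auto simp: U_pow_def)
  show ?thesis
    unfolding c
  proof (rule subgroupI)
    show "inv\<^bsub>U n\<^esub> a \<in> (\<lambda>a. a [^]\<^bsub>U n\<^esub> d) ` carrier (U n)"
      if "a \<in> (\<lambda>a. a [^]\<^bsub>U n\<^esub> d) ` carrier (U n)" for a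
      using that by (auto simp flip: nat_pow_inv)
    show "a \<otimes>\<^bsub>U n\<^esub> b \<in> (\<lambda>a. a [^]\<^bsub>U n\<^esub> d) ` carrier (U n)"
      if "a \<in> (\<lambda>a. a [^]\<^bsub>U n\<^esub> d) ` carrier (U n)"
         "b \<in> (\<lambda>a. a [^]\<^bsub>U n\<^esub> d) ` carrier (U n)" for a b
      using that by (auto simp flip: nat_pow_distrib)
  qed auto
qed

end

theory Submission
  imports Defs "HOL-Algebra.Multiplicative_Group" "HOL-Algebra.Elementary_Groups"
    "HOL-Number_Theory.Number_Theory" "HOL-Computational_Algebra.Squarefree"
begin

text \<open>
  A finite abelian group is a direct product of cyclic groups \<open>C\<^sub>m\<close>, so it suffices to produce each
  factor as the group of \<open>d\<close>-th powers modulo some prime, with pairwise different primes and one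
  common exponent \<open>d\<close>; the Chinese remainder theorem then assembles the factors. The group \<open>U p\<close> is
  cyclic of order \<open>p - 1\<close>, so its \<open>d\<close>-th powers form a cyclic group of order
  \<open>(p - 1) / gcd d (p - 1)\<close>. The difficulty is that \<open>d\<close> must be the same for all primes.

  Let \<open>N\<close> be the order of the group. If \<open>p - 1 = N * t * m\<close> with \<open>m\<close> dividing \<open>N\<close> and \<open>t\<close> coprime to
  \<open>N\<close>, then for every multiple \<open>T\<close> of \<open>t\<close> that is coprime to \<open>N\<close> the exponent \<open>d = N * T\<close> satisfies
  \<open>gcd d (p - 1) = N * t\<close> and leaves a cyclic group of order \<open>m\<close>. All exponents \<open>d\<close> of this kind work
  simultaneously for all factors as soon as \<open>T\<close> is a common multiple of the numbers \<open>t\<close>, for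
  instance their product. A prime of this form is any prime \<open>p\<close> that is congruent to \<open>1 + m * N\<close>
  modulo \<open>m * N\<^sup>2\<close>, because then \<open>t\<close> is congruent to \<open>1\<close> modulo \<open>N\<close>. Infinitely many such primes exist by
  Dirichlet's theorem on primes in arithmetic progressions.

  Two larger facts are therefore established on the way.

  \<^item> The cyclic decomposition comes from characters: a faithful character of the powers of an element
    \<open>g\<close> of maximal order extends to the whole group, and its kernel is a complement of the
    powers of \<open>g\<close> (\<open>cyclic_direct_factor\<close>).

  \<^item> Dirichlet's theorem (\<open>dirichlet_primes_in_progression\<close>) is proved with finite sums, following
    Mertens and Shapiro. The sums of \<open>\<chi> m * \<Lambda> m / m\<close> over \<open>m \<le> x\<close> are \<open>ln x + O(1)\<close> for the
    principal character and \<open>O(1)\<close> for every other \<open>\<chi>\<close> with \<open>L(1,\<chi>) \<noteq> 0\<close>; orthogonality of characters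
    then gives a divergent sum of \<open>\<Lambda> m / m\<close> over the progression. If \<open>L(1,\<chi>) = 0\<close>, the sum
    is \<open>- ln x + O(1)\<close>. For a \<open>\<chi>\<close> with non-real values this would happen for \<open>\<chi>\<close> and its conjugate together,
    and the sum over the progression of \<open>1\<close> would tend to minus infinity, although its
    terms are nonnegative. For real \<open>\<chi>\<close> the vanishing is excluded by Monsky's
    argument with the Lambert series of \<open>\<chi>\<close> (\<open>real_character_L_ne_0\<close>).
\<close>

section \<open>Characters of finite abelian groups\<close>

text \<open>
  A homomorphism from \<open>H\<close> to the nonzero complex numbers, as a total function: in this form a character and
  its extensions have the same type.
\<close>

definition (in comm_group) character_on :: "'a set \<Rightarrow> ('a \<Rightarrow> complex) \<Rightarrow> bool" where
  "character_on H \<phi> \<longleftrightarrow>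
     (\<forall>x\<in>H. \<phi> x \<noteq> 0) \<and> (\<forall>x\<in>H. \<forall>y\<in>H. \<phi> (x \<otimes> y) = \<phi> x * \<phi> y)"

lemma ex_complex_nth_root:
  assumes "k > 0"
  shows "\<exists>c::complex. c ^ k = z"
proof
  show "rcis (root k (cmod z)) (Arg z / real k) ^ k = z"
    using assms by (simp add: DeMoivre2 rcis_cmod_Arg)
qed

lemma cis_pow_eq_1_imp_dvd:
  assumes "m > 0" "cis (2 * pi / real m) ^ n = 1"
  shows "m dvd n"
proof -
  have 1: "cis (2 * pi / real m) ^ m = 1" using assms by (simp add: DeMoivre)
  have "cis (2 * pi / real m) ^ n = (cis (2 * pi / real m) ^ m) ^ (n div m) * cis (2 * pi / real m) ^ (n mod m)"
    by (simp flip: power_mult power_add)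
  then have "cis (2 * pi / real m) ^ (n mod m) = 1" using assms 1 by simp
  then have "cis (2 * pi * real (n mod m) / real m) = cis (2 * pi * real 0 / real m)"
    by (simp add: DeMoivre mult_ac)
  then have "n mod m = 0"
    using inj_onD[OF bij_betw_imp_inj_on[OF bij_betw_roots_unity[OF assms(1)]], of "n mod m" 0] assms(1)
    by simp
  then show ?thesis by auto
qed

context comm_group
begin

lemma subgroup_nat_pow_closed: "subgroup H G \<Longrightarrow> x \<in> H \<Longrightarrow> x [^] (n::nat) \<in> H"
  by (induction n) (auto simp: subgroup.one_closed subgroup.m_closed)

lemma character_on_one: "character_on H \<phi> \<Longrightarrow> subgroup H G \<Longrightarrow> \<phi> \<one> = 1"
  unfolding character_on_def by (metis l_one mult_cancel_right2 one_closed subgroup.one_closed)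

lemma character_on_pow:
  assumes "character_on H \<phi>" "subgroup H G" "x \<in> H"
  shows "\<phi> (x [^] (n::nat)) = \<phi> x ^ n"
proof (induction n)
  case 0
  then show ?case using assms character_on_one by simp
next
  case (Suc n)
  with assms subgroup_nat_pow_closed[of H x n] show ?case by (simp add: character_on_def)
qed

text \<open>
  If \<open>k\<close> is the least positive exponent with \<open>x [^] k \<in> H\<close>, the only obstruction to sending \<open>x\<close> to \<open>c\<close>
  is the relation \<open>c ^ k = \<phi> (x [^] k)\<close>. Leaving \<open>c\<close> open allows the same step to prescribe a
  faithful value on the powers of a single element (with \<open>H\<close> trivial) and to choose an arbitrary root when
  extending further.
\<close>

lemma character_extend_by_element:
  assumes H: "subgroup H G" and \<phi>: "character_on H \<phi>" and x: "x \<in> carrier G"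
    and k: "k > 0" "x [^] k \<in> H" "\<And>i::nat. x [^] i \<in> H \<Longrightarrow> k dvd i"
    and c: "c ^ k = \<phi> (x [^] k)"
  obtains H' \<phi>' where "subgroup H' G" "H \<subseteq> H'" "x \<in> H'" "character_on H' \<phi>'"
    "\<And>h. h \<in> H \<Longrightarrow> \<phi>' h = \<phi> h" "\<phi>' x = c"
proof -
  interpret H: subgroup H G by (rule H)
  have Hc: "h \<in> carrier G" if "h \<in> H" for h using that H.subset by auto
  have "\<phi> (x [^] k) \<noteq> 0" using k \<phi> by (auto simp: character_on_def)
  with c k have c0: "c \<noteq> 0" by (auto simp: power_0_left)
  have le: "\<phi> h * c ^ i = \<phi> h' * c ^ j"
    if h: "h \<in> H" "h' \<in> H" "h \<otimes> x [^] i = h' \<otimes> x [^] j" and ij: "i \<le> j" for h h' and i j :: nat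
  proof -
    have "x [^] j = x [^] (j - i) \<otimes> x [^] i" using x ij by (simp add: nat_pow_mult)
    then have "h \<otimes> x [^] i = (h' \<otimes> x [^] (j - i)) \<otimes> x [^] i" using h x by (simp add: m_assoc Hc)
    then have hh: "h = h' \<otimes> x [^] (j - i)" using h x by (simp add: Hc)
    then have eq: "x [^] (j - i) = inv h' \<otimes> h" using h x by (simp add: Hc m_assoc[symmetric])
    then have mem: "x [^] (j - i) \<in> H" using h by simp
    then obtain q where q: "j - i = k * q" using k(3) by (auto simp: dvd_def)
    have "\<phi> (x [^] (j - i)) = \<phi> (x [^] k) ^ q"
      using character_on_pow[OF \<phi> H k(2), of q] x by (simp add: q nat_pow_pow)
    also have "\<dots> = c ^ (j - i)" by (simp add: q power_mult c)
    finally have "\<phi> h = \<phi> h' * c ^ (j - i)"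
      using hh h mem \<phi> by (metis character_on_def)
    then show ?thesis using ij by (simp add: power_add[symmetric])
  qed
  have wd: "\<phi> h * c ^ i = \<phi> h' * c ^ j"
    if h: "h \<in> H" "h' \<in> H" "h \<otimes> x [^] i = h' \<otimes> x [^] j" for h h' and i j :: nat
  proof (cases "i \<le> j")
    case True
    then show ?thesis by (rule le[OF h])
  next
    case False
    then show ?thesis using le[OF h(2,1) h(3)[symmetric]] by simp
  qed
  \<comment> \<open>The extension maps \<open>h \<otimes> x [^] j\<close> to \<open>\<phi> h * c ^ j\<close>, which is well defined by the previous step.\<close>
  define H' where "H' = {h \<otimes> x [^] (j::nat) | h j. h \<in> H}"
  define \<phi>' where "\<phi>' y = (SOME z. \<exists>h (j::nat). h \<in> H \<and> y = h \<otimes> x [^] j \<and> z = \<phi> h * c ^ j)" for y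
  have \<phi>': "\<phi>' (h \<otimes> x [^] j) = \<phi> h * c ^ j" if "h \<in> H" for h and j :: nat
    unfolding \<phi>'_def
  proof (rule some_equality)
    show "\<exists>h' (j'::nat). h' \<in> H \<and> h \<otimes> x [^] j = h' \<otimes> x [^] j' \<and> \<phi> h * c ^ j = \<phi> h' * c ^ j'"
      using that by blast
    show "z = \<phi> h * c ^ j"
      if z: "\<exists>h' (j'::nat). h' \<in> H \<and> h \<otimes> x [^] j = h' \<otimes> x [^] j' \<and> z = \<phi> h' * c ^ j'" for z
    proof -
      from z obtain h' and j' :: nat
        where "h' \<in> H" "h \<otimes> x [^] j = h' \<otimes> x [^] j'" "z = \<phi> h' * c ^ j'" by blast
      then show ?thesis using wd[OF \<open>h \<in> H\<close>, of h' j j'] by simp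
    qed
  qed
  have mult: "(h \<otimes> x [^] i) \<otimes> (h' \<otimes> x [^] j) = (h \<otimes> h') \<otimes> x [^] (i + j)"
    if "h \<in> H" "h' \<in> H" for h h' and i j :: nat
    using that x by (simp add: Hc nat_pow_mult[symmetric] m_ac)
  have H'I: "h \<otimes> x [^] j \<in> H'" if "h \<in> H" for h and j :: nat
    using that unfolding H'_def by blast
  have "subgroup H' G"
  proof (rule subgroupI)
    show "H' \<subseteq> carrier G" using Hc x by (auto simp: H'_def)
    show "H' \<noteq> {}" using H'I[OF H.one_closed] by blast
    show "inv a \<in> H'" if a: "a \<in> H'" for a
    proof -
      from a obtain h and j :: nat where a: "h \<in> H" "a = h \<otimes> x [^] j" by (auto simp: H'_def)
      have y: "x [^] (k * j) \<in> H"
        using subgroup_nat_pow_closed[OF H k(2), of j] x by (simp add: nat_pow_pow)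
      \<comment> \<open>An inverse written with nonnegative exponents only: \<open>x [^] (k * j)\<close> lies in \<open>H\<close>.\<close>
      let ?b = "inv (h \<otimes> x [^] (k * j)) \<otimes> x [^] (j * (k - 1))"
      have "j + j * (k - 1) = k * j" using k(1) by (cases k) auto
      then have "?b \<otimes> a = (inv (h \<otimes> x [^] (k * j)) \<otimes> h) \<otimes> x [^] (k * j)"
        unfolding a using mult[of "inv (h \<otimes> x [^] (k * j))" h "j * (k - 1)" j] a y
        by (simp add: add.commute)
      also have "\<dots> = \<one>" using a y x by (simp add: Hc m_assoc)
      finally have "inv a = ?b" using a y x Hc by (intro inv_equality) auto
      moreover have "?b \<in> H'" using a y by (intro H'I) simp
      ultimately show ?thesis by simp
    qed
    show "a \<otimes> b \<in> H'" if "a \<in> H'" "b \<in> H'" for a b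
    proof -
      from that obtain h h' and i j :: nat
        where "h \<in> H" "h' \<in> H" "a = h \<otimes> x [^] i" "b = h' \<otimes> x [^] j"
        by (auto simp: H'_def)
      then show ?thesis using mult[of h h' i j] H'I[of "h \<otimes> h'" "i + j"] by simp
    qed
  qed
  moreover have "H \<subseteq> H'"
  proof
    fix h assume "h \<in> H"
    then have "h = h \<otimes> x [^] (0::nat)" using Hc by simp
    then show "h \<in> H'" using H'I[OF \<open>h \<in> H\<close>, of 0] by simp
  qed
  moreover have "x = \<one> \<otimes> x [^] (1::nat)" using x by simp
  then have "x \<in> H'" using H'I[OF H.one_closed, of 1] by simp
  moreover have "character_on H' \<phi>'"
    unfolding character_on_def
  proof (intro conjI ballI)
    show "\<phi>' a \<noteq> 0" if "a \<in> H'" for a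
      using that \<phi>' c0 \<phi> by (auto simp: H'_def character_on_def)
    show "\<phi>' (a \<otimes> b) = \<phi>' a * \<phi>' b" if "a \<in> H'" "b \<in> H'" for a b
      using that \<phi>' mult \<phi> by (auto simp: H'_def character_on_def power_add)
  qed
  moreover have "\<phi>' h = \<phi> h" if "h \<in> H" for h
    using \<phi>'[OF that, of 0] that Hc by simp
  moreover have "\<phi>' x = c"
    using \<phi>'[OF H.one_closed, of 1] x character_on_one[OF \<phi> H] by simp
  ultimately show ?thesis using that by blast
qed

text \<open>
  The nonzero complex numbers are divisible, so a root \<open>c\<close> as required above always exists and
  a subgroup can be enlarged one element at a time.
\<close>

lemma character_extend:
  assumes fin: "finite (carrier G)" and H: "subgroup H G" and \<phi>: "character_on H \<phi>"
  shows "\<exists>\<phi>'. character_on (carrier G) \<phi>' \<and> (\<forall>h\<in>H. \<phi>' h = \<phi> h)"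
  using H \<phi>
proof (induction "card (carrier G - H)" arbitrary: H \<phi> rule: less_induct)
  case less
  interpret H: subgroup H G by (rule less.prems)
  show ?case
  proof (cases "H = carrier G")
    case True
    then show ?thesis using less.prems by blast
  next
    case False
    then obtain x where x: "x \<in> carrier G" "x \<notin> H" using H.subset by blast
    define k where "k = (LEAST k::nat. k > 0 \<and> x [^] k \<in> H)"
    have "ord x > 0 \<and> x [^] ord x \<in> H"
      using ord_ge_1[OF fin x(1)] x by simp
    then have k: "k > 0 \<and> x [^] k \<in> H" unfolding k_def by (rule LeastI)
    have dvd: "k dvd i" if i: "x [^] i \<in> H" for i
    proof -
      let ?q = "k * (i div k)"
      have q: "x [^] ?q \<in> H"
        using subgroup_nat_pow_closed[OF less.prems(1), of "x [^] k" "i div k"] k x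
        by (simp add: nat_pow_pow)
      have "x [^] i = x [^] ?q \<otimes> x [^] (i mod k)" using x by (simp add: nat_pow_mult)
      then have "x [^] (i mod k) = inv (x [^] ?q) \<otimes> x [^] i" using x by (simp add: m_assoc[symmetric])
      then have "x [^] (i mod k) \<in> H" using q i by simp
      then have "i mod k = 0"
        using not_less_Least[of "i mod k" "\<lambda>k. k > 0 \<and> x [^] k \<in> H"] k
        by (auto simp: k_def[symmetric])
      then show ?thesis by auto
    qed
    obtain c where c: "c ^ k = \<phi> (x [^] k)" using ex_complex_nth_root k by blast
    obtain H' \<phi>' where H': "subgroup H' G" "H \<subseteq> H'" "x \<in> H'" "character_on H' \<phi>'"
      "\<And>h. h \<in> H \<Longrightarrow> \<phi>' h = \<phi> h"
      by (rule character_extend_by_element[OF less.prems x(1), of k c]) (use k dvd c in blast)+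
    have "carrier G - H' \<subset> carrier G - H" using H' x by blast
    then have "card (carrier G - H') < card (carrier G - H)"
      using fin by (intro psubset_card_mono) auto
    from less.hyps[OF this H'(1,4)] obtain \<psi>
      where "character_on (carrier G) \<psi>" "\<forall>h\<in>H'. \<psi> h = \<phi>' h" by blast
    moreover from this H'(2,5) have "\<forall>h\<in>H. \<psi> h = \<phi> h" by auto
    ultimately show ?thesis by blast
  qed
qed

lemma ex_character_faithful_on_powers:
  assumes fin: "finite (carrier G)" and x: "x \<in> carrier G"
  obtains \<phi> where "character_on (carrier G) \<phi>" "\<phi> x = cis (2 * pi / real (ord x))"
proof -
  have pos: "ord x > 0" using ord_ge_1[OF fin x] by simp
  have one: "subgroup {\<one>} G" by (rule triv_subgroup)
  have char: "character_on {\<one>} (\<lambda>_. 1)" by (simp add: character_on_def)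
  have root: "cis (2 * pi / real (ord x)) ^ ord x = 1" using pos by (simp add: DeMoivre)
  obtain H \<phi> where H: "subgroup H G" "x \<in> H" "character_on H \<phi>"
      "\<phi> x = cis (2 * pi / real (ord x))"
    by (rule character_extend_by_element[OF one char x pos _ _ root])
      (use x in \<open>auto simp: pow_eq_id\<close>)
  obtain \<psi> where "character_on (carrier G) \<psi>" "\<forall>h\<in>H. \<psi> h = \<phi> h"
    using character_extend[OF fin H(1,3)] by blast
  with H that show ?thesis by auto
qed

end

section \<open>Splitting off a cyclic direct factor\<close>

context comm_group
begin

text \<open>
  An element of maximal order works: if a prime \<open>p\<close> divided \<open>ord y\<close> to a higher power \<open>p ^ k\<close> than
  \<open>ord g\<close>, then the part of \<open>g\<close> of order prime to \<open>p\<close>, times the \<open>p\<close>-part of \<open>y\<close>, would have a larger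
  order than \<open>g\<close>.
\<close>

lemma ex_ord_eq_exponent:
  assumes fin: "finite (carrier G)"
  obtains g where "g \<in> carrier G" "\<And>y. y \<in> carrier G \<Longrightarrow> ord y dvd ord g"
proof -
  have "finite (ord ` carrier G)" "ord ` carrier G \<noteq> {}" using fin by auto
  then have "Max (ord ` carrier G) \<in> ord ` carrier G" by (rule Max_in)
  then obtain g where g: "g \<in> carrier G" "ord g = Max (ord ` carrier G)" by auto
  have max: "ord y \<le> ord g" if "y \<in> carrier G" for y
    using \<open>finite (ord ` carrier G)\<close> that g(2) by simp
  note g = g(1)
  have pos: "ord y > 0" if "y \<in> carrier G" for y using ord_ge_1[OF fin that] by simp
  have "ord y dvd ord g" if y: "y \<in> carrier G" for y
  proof (rule ccontr)
    assume "\<not> ord y dvd ord g"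
    then obtain p where p: "prime p" "multiplicity p (ord g) < multiplicity p (ord y)"
      using multiplicity_le_imp_dvd[of "ord y" "ord g"] pos[OF y]
      by (metis linorder_not_le neq0_conv)
    define j k where "j = multiplicity p (ord g)" "k = multiplicity p (ord y)"
    obtain a where a: "ord g = p ^ j * a" "\<not> p dvd a"
      using multiplicity_decompose'[of "ord g" p] pos[OF g] p unfolding j_k_def
      by (metis neq0_conv not_prime_unit)
    obtain b where b: "ord y = p ^ k * b"
      unfolding j_k_def using multiplicity_dvd by (metis dvdE)
    have p0: "p > 0" using p prime_gt_0_nat by blast
    have b0: "b > 0" "a > 0" using b a pos[OF y] pos[OF g] by (auto intro: gr0I)
    let ?u = "g [^] (p ^ j)" and ?v = "y [^] b"
    have u: "ord ?u = a" using ord_pow[OF g, of "p ^ j"] a p0 by simp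
    have v: "ord ?v = p ^ k" using ord_pow[OF y, of b] b b0 by simp
    have c: "?u \<in> carrier G" "?v \<in> carrier G" using g y by auto
    have cop: "coprime a (p ^ k)" using prime_imp_coprime[OF p(1) a(2)] by (simp add: coprime_commute)
    have "a * p ^ k dvd ord (?u \<otimes> ?v)"
    proof -
      let ?n = "ord (?u \<otimes> ?v)"
      have e: "?u [^] ?n \<otimes> ?v [^] ?n = \<one>"
        using c by (metis m_closed nat_pow_distrib pow_ord_eq_1)
      have "a dvd ?n * p ^ k"
      proof -
        have "(?u [^] ?n \<otimes> ?v [^] ?n) [^] (p ^ k) = \<one>" unfolding e by simp
        then have "?u [^] (?n * p ^ k) \<otimes> ?v [^] (?n * p ^ k) = \<one>"
          using c by (simp add: nat_pow_distrib nat_pow_pow del: pow_ord_eq_1)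
        moreover have "?v [^] (?n * p ^ k) = \<one>" using c(2) v by (simp only: pow_eq_id) simp
        ultimately have "?u [^] (?n * p ^ k) = \<one>" using c by (metis nat_pow_closed r_one)
        then show ?thesis using c(1) u by (simp only: pow_eq_id)
      qed
      moreover have "p ^ k dvd ?n * a"
      proof -
        have "(?u [^] ?n \<otimes> ?v [^] ?n) [^] a = \<one>" unfolding e by simp
        then have "?u [^] (?n * a) \<otimes> ?v [^] (?n * a) = \<one>"
          using c by (simp add: nat_pow_distrib nat_pow_pow del: pow_ord_eq_1)
        moreover have "?u [^] (?n * a) = \<one>" using c(1) u by (simp only: pow_eq_id) simp
        ultimately have "?v [^] (?n * a) = \<one>" using c by (metis nat_pow_closed l_one)
        then show ?thesis using c(2) v by (simp only: pow_eq_id)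
      qed
      ultimately show ?thesis
        using cop by (metis coprime_commute coprime_dvd_mult_left_iff divides_mult)
    qed
    then have "a * p ^ k \<le> ord (?u \<otimes> ?v)" using pos c by (intro dvd_imp_le) auto
    also have "\<dots> \<le> ord g" using max c by blast
    finally have "p ^ k \<le> p ^ j" using a b0 by simp
    then show False using p prime_gt_1_nat[of p] by (simp add: j_k_def)
  qed
  then show ?thesis using that g by blast
qed

text \<open>
  The complement \<open>K\<close> is the kernel of a character \<open>\<phi>\<close> that is faithful on the powers of \<open>g\<close>. Faithfulness
  makes the intersection trivial. Since \<open>ord g\<close> is an exponent of the group, every value
  of \<open>\<phi>\<close> is an \<open>ord g\<close>-th root of unity and hence already the value of a power of \<open>g\<close>; dividing by that
  power lands in \<open>K\<close>.
\<close>

lemma cyclic_direct_factor: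
  assumes fin: "finite (carrier G)" and g: "g \<in> carrier G"
    and exp: "\<And>y. y \<in> carrier G \<Longrightarrow> ord y dvd ord g"
  obtains K where "subgroup K G" "integer_mod_group (ord g) \<times>\<times> G\<lparr>carrier := K\<rparr> \<cong> G"
proof -
  define m where "m = ord g"
  have m: "m > 0" using ord_ge_1[OF fin g] by (simp add: m_def)
  obtain \<phi> where \<phi>: "character_on (carrier G) \<phi>" "\<phi> g = cis (2 * pi / real m)"
    using ex_character_faithful_on_powers[OF fin g] unfolding m_def by blast
  have mul: "\<phi> (x \<otimes> y) = \<phi> x * \<phi> y" if "x \<in> carrier G" "y \<in> carrier G" for x y
    using \<phi> that by (auto simp: character_on_def)
  have nz: "\<phi> x \<noteq> 0" if "x \<in> carrier G" for x
    using \<phi> that by (auto simp: character_on_def)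
  have one: "\<phi> \<one> = 1" using character_on_one[OF \<phi>(1) subgroup_self] .
  have inv: "\<phi> (inv x) = inverse (\<phi> x)" if "x \<in> carrier G" for x
    using mul[of x "inv x"] that one nz[of x] by (simp add: field_simps)
  have pow: "\<phi> (x [^] (n::nat)) = \<phi> x ^ n" if "x \<in> carrier G" for x n
    using character_on_pow[OF \<phi>(1) subgroup_self that] .
  define K where "K = {y \<in> carrier G. \<phi> y = 1}"
  have K: "subgroup K G"
    by (rule subgroupI) (auto simp: K_def one inv mul)
  have gK: "int m dvd i" if "g [^] (i::int) \<in> K" for i
  proof -
    have "g [^] i = g [^] (i mod int m)"
      using g by (simp add: int_pow_eq m_def[symmetric] mod_eq_dvd_iff[symmetric])
    also have "\<dots> = g [^] nat (i mod int m)"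
      using m by (simp add: pow_nat)
    finally have "\<phi> (g [^] i) = cis (2 * pi / real m) ^ nat (i mod int m)"
      using pow g \<phi> by simp
    with that have "m dvd nat (i mod int m)"
      using cis_pow_eq_1_imp_dvd[OF m] by (auto simp: K_def)
    moreover have "nat (i mod int m) < m" using m by (simp add: nat_less_iff)
    ultimately have "nat (i mod int m) = 0" by (metis nat_dvd_not_less neq0_conv)
    then have "i mod int m = 0"
      using m pos_mod_sign[of "int m" i] by linarith
    then show ?thesis by auto
  qed
  let ?f = "\<lambda>(i::int, y). g [^] i \<otimes> y"
  have car: "carrier (integer_mod_group m \<times>\<times> G\<lparr>carrier := K\<rparr>) = {0..<int m} \<times> K"
    using m by (simp add: carrier_integer_mod_group)
  have gm: "g [^] (i mod int m) = g [^] i" for i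
    using g by (simp add: int_pow_eq m_def[symmetric] mod_eq_dvd_iff[symmetric])
  have KG: "y \<in> carrier G" if "y \<in> K" for y using that by (simp add: K_def)
  have "?f \<in> iso (integer_mod_group m \<times>\<times> G\<lparr>carrier := K\<rparr>) G"
  proof (rule isoI)
    show "?f \<in> hom (integer_mod_group m \<times>\<times> G\<lparr>carrier := K\<rparr>) G"
    proof (rule homI)
      show "?f z \<in> carrier G" if "z \<in> carrier (integer_mod_group m \<times>\<times> G\<lparr>carrier := K\<rparr>)" for z
        using that g KG by (auto simp: car)
      show "?f (z \<otimes>\<^bsub>integer_mod_group m \<times>\<times> G\<lparr>carrier := K\<rparr>\<^esub> w) = ?f z \<otimes> ?f w"
        if "z \<in> carrier (integer_mod_group m \<times>\<times> G\<lparr>carrier := K\<rparr>)"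
           "w \<in> carrier (integer_mod_group m \<times>\<times> G\<lparr>carrier := K\<rparr>)" for z w
        using that g KG unfolding car by (auto simp: gm int_pow_mult m_ac)
    qed
    show "bij_betw ?f (carrier (integer_mod_group m \<times>\<times> G\<lparr>carrier := K\<rparr>)) (carrier G)"
      unfolding car bij_betw_def
    proof
      show "inj_on ?f ({0..<int m} \<times> K)"
      proof (rule inj_onI, clarify)
        fix i y j z
        assume ij: "i \<in> {0..<int m}" "j \<in> {0..<int m}" and yz: "y \<in> K" "z \<in> K"
          and eq: "g [^] i \<otimes> y = g [^] j \<otimes> z"
        have "g [^] (i - j) = z \<otimes> inv y"
        proof -
          have "g [^] i = g [^] j \<otimes> (z \<otimes> inv y)"
            using eq g yz KG by (metis inv_closed inv_solve_right int_pow_closed m_assoc m_closed)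
          then show ?thesis
            using g yz KG by (metis diff_conv_add_uminus int_pow_closed int_pow_diff inv_closed
                inv_solve_left' m_closed m_comm)
        qed
        moreover have "z \<otimes> inv y \<in> K" using yz K by (simp add: subgroup.m_closed subgroup.m_inv_closed)
        ultimately have "int m dvd i - j" using gK by metis
        then have "i = j" using ij by (auto dest!: zdvd_imp_le split: if_splits
            simp: mod_eq_dvd_iff[symmetric])
        then show "i = j \<and> y = z" using eq g yz KG by auto
      qed
      show "?f ` ({0..<int m} \<times> K) = carrier G"
      proof
        show "?f ` ({0..<int m} \<times> K) \<subseteq> carrier G" using g KG by auto
        show "carrier G \<subseteq> ?f ` ({0..<int m} \<times> K)"
        proof
          fix x assume x: "x \<in> carrier G"
          have "x [^] m = \<one>" using exp[OF x] x by (simp add: pow_eq_id m_def)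
          then have "\<phi> x ^ m = 1" using pow[OF x, of m] one by simp
          then have "\<phi> x \<in> (\<lambda>k. cis (2 * pi * real k / real m)) ` {..<m}"
            using bij_betw_imp_surj_on[OF bij_betw_roots_unity[OF m]] by auto
          then obtain k where k: "k < m" "\<phi> x = cis (2 * pi * real k / real m)" by auto
          then have phk: "\<phi> x = \<phi> (g [^] k)" using pow[OF g, of k] \<phi>(2) by (simp add: DeMoivre mult_ac)
          let ?y = "inv (g [^] k) \<otimes> x"
          have "?y \<in> K" using x g nz[of "g [^] k"] by (simp add: K_def mul inv phk)
          moreover have "?f (int k, ?y) = x"
            using x g by (simp add: int_pow_int m_assoc[symmetric])
          moreover have "int k \<in> {0..<int m}" using k by simp
          ultimately show "x \<in> ?f ` ({0..<int m} \<times> K)" by (metis (no_types, lifting) SigmaI image_eqI)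
        qed
      qed
    qed
  qed
  then show ?thesis using that K unfolding m_def by (blast intro: is_isoI)
qed

end

section \<open>Sums over divisors and summation by parts\<close>

text \<open>
  Both sides run over the pairs \<open>(d, e)\<close> with \<open>d * e \<le> x\<close>. This is how every Dirichlet convolution below
  is turned into a summatory identity.
\<close>

lemma sum_divisors_swap:
  fixes f :: "nat \<Rightarrow> nat \<Rightarrow> 'a::comm_monoid_add"
  shows "(\<Sum>m=1..x. \<Sum>d | d dvd m. f d (m div d)) = (\<Sum>d=1..x. \<Sum>e=1..x div d. f d e)"
proof -
  have "(\<Sum>m=1..x. \<Sum>d | d dvd m. f d (m div d))
      = (\<Sum>(m,d)\<in>(SIGMA m:{1..x}. {d. d dvd m}). f d (m div d))"
    by (rule sum.Sigma) auto
  also have "\<dots> = (\<Sum>(d,e)\<in>(SIGMA d:{1..x}. {1..x div d}). f d e)"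
  proof (rule sum.reindex_bij_witness[of _ "\<lambda>(d,e). (d * e, d)" "\<lambda>(m,d). (d, m div d)"])
    fix z assume "z \<in> (SIGMA m:{1..x}. {d. d dvd m})"
    then obtain d e where z: "z = (d * e, d)" "1 \<le> d * e" "d * e \<le> x" by (auto elim!: dvdE)
    then have "d > 0" "e > 0" by (auto intro: gr0I)
    moreover have "d \<le> d * e" using \<open>e > 0\<close> by simp
    then have "d \<le> x" using z by linarith
    ultimately show "(case z of (m, d) \<Rightarrow> (d, m div d)) \<in> (SIGMA d:{1..x}. {1..x div d})"
        "(case (case z of (m, d) \<Rightarrow> (d, m div d)) of (d, e) \<Rightarrow> (d * e, d)) = z"
        "(case (case z of (m, d) \<Rightarrow> (d, m div d)) of (d, e) \<Rightarrow> f d e) = (case z of (m, d) \<Rightarrow> f d (m div d))"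
      using z by (auto simp: less_eq_div_iff_mult_less_eq mult.commute)
  next
    fix z assume "z \<in> (SIGMA d:{1..x}. {1..x div d})"
    then obtain d e where z: "z = (d, e)" "d > 0" "e > 0" "e \<le> x div d" by auto
    then have "d * e \<le> x" by (simp add: less_eq_div_iff_mult_less_eq mult.commute)
    then show "(case z of (d, e) \<Rightarrow> (d * e, d)) \<in> (SIGMA m:{1..x}. {d. d dvd m})"
        "(case (case z of (d, e) \<Rightarrow> (d * e, d)) of (m, d) \<Rightarrow> (d, m div d)) = z"
      using z by (auto simp: Suc_le_eq)
  qed
  also have "\<dots> = (\<Sum>d=1..x. \<Sum>e=1..x div d. f d e)"
    by (rule sum.Sigma[symmetric]) auto
  finally show ?thesis .
qed

lemma divide_less_Suc_div:
  assumes "d > 0"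
  shows "real x / real d < real (x div d) + 1"
proof -
  have "x < (x div d + 1) * d"
    using assms dividend_less_div_times[of d x] by (simp add: algebra_simps)
  then have "real x < real ((x div d + 1) * d)" by (rule less_imp_of_nat_less)
  then show ?thesis using assms by (simp add: divide_less_eq algebra_simps)
qed

text \<open>
  Abel summation: a decreasing nonnegative weight makes a sum no larger than its first weight
  times a bound of the unweighted partial sums.
\<close>

lemma norm_sum_decreasing_weights_le:
  fixes c :: "nat \<Rightarrow> 'a::real_normed_vector" and f :: "nat \<Rightarrow> real"
  assumes c: "\<And>m. norm (\<Sum>k=a..m. c k) \<le> C"
    and dec: "\<And>k. a \<le> k \<Longrightarrow> f (Suc k) \<le> f k" and nonneg: "\<And>k. a \<le> k \<Longrightarrow> 0 \<le> f k"
  shows "norm (\<Sum>k=a..b. f k *\<^sub>R c k) \<le> C * f a"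
proof -
  have C: "C \<ge> 0" using c[of 0] norm_ge_zero order_trans by blast
  show ?thesis
  proof (cases "a \<le> b")
    case False
    then show ?thesis using C nonneg[of a] by simp
  next
    case True
    define S where "S m = (\<Sum>k=a..m. c k)" for m
    have "norm ((\<Sum>k=a..b. f k *\<^sub>R c k) - f b *\<^sub>R S b) \<le> C * (f a - f b)"
      using True
    proof (induction b rule: dec_induct)
      case base
      then show ?case by (simp add: S_def)
    next
      case (step m)
      have "(\<Sum>k=a..Suc m. f k *\<^sub>R c k) - f (Suc m) *\<^sub>R S (Suc m)
          = ((\<Sum>k=a..m. f k *\<^sub>R c k) - f m *\<^sub>R S m) + (f m - f (Suc m)) *\<^sub>R S m"
        using step.hyps by (simp add: S_def algebra_simps)
      also have "norm \<dots> \<le> C * (f a - f m) + (f m - f (Suc m)) * C"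
        using step dec[of m] c[of m] unfolding S_def[symmetric]
        by (intro order_trans[OF norm_triangle_ineq] add_mono) (auto intro!: mult_left_mono)
      finally show ?case by (simp add: algebra_simps)
    qed
    moreover have "norm (f b *\<^sub>R S b) \<le> f b * C"
      using nonneg[OF True] c[of b] by (simp add: S_def mult_left_mono)
    ultimately have "norm (\<Sum>k=a..b. f k *\<^sub>R c k) \<le> C * (f a - f b) + f b * C"
      using norm_triangle_sub[of "\<Sum>k=a..b. f k *\<^sub>R c k" "f b *\<^sub>R S b"] by linarith
    then show ?thesis by (simp add: algebra_simps)
  qed
qed

section \<open>Chebyshev and Mertens estimates for the von Mangoldt function\<close>

lemma ln_fact_ge: "real n * ln n - n \<le> ln (fact n)"
proof (induction n)
  case 0
  then show ?case by simp
next
  case (Suc n)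
  show ?case
  proof (cases "n = 0")
    case False
    then have "ln (1 + 1 / real n) \<le> 1 / real n" by (intro ln_add_one_self_le_self) simp
    moreover have "1 + 1 / real n = (real n + 1) / n" using False by (simp add: field_simps)
    ultimately have "ln (real n + 1) - ln n \<le> 1 / real n" using False by (simp add: ln_div)
    then have "real n * (ln (real n + 1) - ln n) \<le> 1" using False by (simp add: field_simps)
    moreover have "ln (fact (Suc n) :: real) = ln (real n + 1) + ln (fact n)"
      by (simp add: ln_mult add.commute)
    ultimately show ?thesis using Suc by (simp add: algebra_simps)
  qed simp
qed

lemma ln_fact_le: "ln (fact n) \<le> real n * ln n"
proof (cases "n = 0")
  case False
  have "ln (fact n) \<le> ln (real (n ^ n))"
    using False fact_le_power[of n, where ?'a = real] by (subst ln_le_cancel_iff) auto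
  then show ?thesis using False by (simp add: ln_realpow)
qed simp

lemma ln_fact_eq_sum: "ln (fact n) = (\<Sum>k=1..n. ln (real k))"
  by (induction n) (auto simp: ln_mult)

text \<open>
  Legendre's formula in logarithmic form, obtained by summing \<open>ln m = (\<Sum>d | d dvd m. mangoldt d)\<close>.
  The Chebyshev bound and both Mertens estimates come from this identity.
\<close>

lemma sum_mangoldt_floor: "(\<Sum>d=1..x. mangoldt d * real (x div d)) = ln (fact x)"
proof -
  have "ln (fact x) = (\<Sum>m=1..x. \<Sum>d | d dvd m. mangoldt d :: real)"
    unfolding ln_fact_eq_sum by (intro sum.cong refl) (simp add: mangoldt_sum)
  also have "\<dots> = (\<Sum>d=1..x. \<Sum>e=1..x div d. mangoldt d)"
    by (rule sum_divisors_swap)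
  finally show ?thesis by (simp add: mult.commute)
qed

definition chebyshev_psi :: "nat \<Rightarrow> real" where
  "chebyshev_psi x = (\<Sum>m=1..x. mangoldt m)"

text \<open>
  The logarithm of the central binomial coefficient \<open>2 * n choose n \<le> 4 ^ n\<close> is a combination of
  \<open>mangoldt d\<close> with nonnegative coefficients that are at least \<open>1\<close> for \<open>n < d \<le> 2 * n\<close>.
\<close>

lemma chebyshev_psi_double: "chebyshev_psi (2 * n) \<le> chebyshev_psi n + 2 * real n"
proof -
  have div_double: "2 * (n div d) \<le> 2 * n div d" for d
    by (cases "d = 0") (auto simp: less_eq_div_iff_mult_less_eq)
  have 1: "mangoldt d \<le> (mangoldt d :: real) * (real (2 * n div d) - 2 * real (n div d))"
    if "d \<in> {n<..2*n}" for d
  proof -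
    from that have "n div d = 0" "2 * n div d \<ge> 1" by (auto simp: Suc_le_eq div_greater_zero_iff)
    then show ?thesis using mangoldt_nonneg[of d] by (simp add: mult_le_cancel_left1)
  qed
  have "chebyshev_psi (2 * n) - chebyshev_psi n = (\<Sum>d\<in>{n<..2*n}. mangoldt d)"
  proof -
    have "{1..2*n} = {1..n} \<union> {n<..2*n}" by auto
    then have "(\<Sum>d=1..2*n. mangoldt d) = (\<Sum>d=1..n. mangoldt d) + (\<Sum>d\<in>{n<..2*n}. mangoldt d :: real)"
      by (simp only:) (rule sum.union_disjoint, auto)
    then show ?thesis unfolding chebyshev_psi_def by simp
  qed
  also have "\<dots> \<le> (\<Sum>d\<in>{n<..2*n}. mangoldt d * (real (2 * n div d) - 2 * real (n div d)))"
    by (rule sum_mono) (rule 1)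
  also have "\<dots> \<le> (\<Sum>d=1..2*n. mangoldt d * (real (2 * n div d) - 2 * real (n div d)))"
  proof (rule sum_mono2)
    show "0 \<le> (mangoldt d :: real) * (real (2 * n div d) - 2 * real (n div d))" for d
      using mangoldt_nonneg[of d] div_double[of d] by (intro mult_nonneg_nonneg) linarith+
  qed auto
  also have "\<dots> = (\<Sum>d=1..2*n. mangoldt d * real (2 * n div d))
      - 2 * (\<Sum>d=1..2*n. mangoldt d * real (n div d))"
    by (simp add: algebra_simps sum_subtractf sum_distrib_left)
  also have "(\<Sum>d=1..2*n. mangoldt d * real (n div d)) = (\<Sum>d=1..n. mangoldt d * real (n div d))"
    by (rule sum.mono_neutral_right) auto
  also have "(\<Sum>d=1..2*n. mangoldt d * real (2 * n div d)) - 2 * (\<Sum>d=1..n. mangoldt d * real (n div d))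
      = ln (fact (2 * n)) - 2 * ln (fact n)"
    by (simp only: sum_mangoldt_floor)
  also have "\<dots> = ln (real (2 * n choose n))"
  proof -
    have "real (2 * n choose n) = fact (2 * n) / (fact n * fact n)"
      by (subst binomial_fact) auto
    then show ?thesis by (simp add: ln_div ln_mult)
  qed
  also have "\<dots> \<le> ln (real (2 ^ (2 * n)))"
    using binomial_le_pow2[of "2 * n" n]
    by (subst ln_le_cancel_iff) (auto simp del: of_nat_power simp: of_nat_le_iff)
  also have "\<dots> = 2 * real n * ln 2" by (simp add: ln_realpow)
  also have "\<dots> \<le> 2 * real n * 1" by (intro mult_left_mono) (use ln_2_less_1 in auto)
  finally show ?thesis by simp
qed

lemma chebyshev_psi_le: "chebyshev_psi x \<le> 4 * real x"
proof (induction x rule: less_induct)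
  case (less x)
  show ?case
  proof (cases "x = 0")
    case True
    then show ?thesis by (simp add: chebyshev_psi_def)
  next
    case False
    define n where "n = x div 2"
    have n: "n < x" using False by (simp add: n_def)
    have dbl: "chebyshev_psi (2 * n) \<le> 4 * real n + 2 * real n"
      using chebyshev_psi_double[of n] less.IH[OF n] by linarith
    show ?thesis
    proof (cases "even x")
      case True
      then have "x = 2 * n" by (simp add: n_def)
      then show ?thesis using dbl by simp
    next
      case False
      then have x: "x = Suc (2 * n)" by (simp add: n_def)
      have "chebyshev_psi x = chebyshev_psi (2 * n) + mangoldt x"
        by (simp add: x chebyshev_psi_def)
      moreover have "mangoldt x \<le> ln (real x)" using x by (intro mangoldt_le) simp
      moreover have "ln (real x) \<le> 2 * real n" using x ln_add_one_self_le_self[of "2 * real n"] by (simp add: add.commute)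
      ultimately show ?thesis using dbl x by simp
    qed
  qed
qed

lemma sum_mangoldt_over_le:
  assumes "x > 0"
  shows "(\<Sum>d=1..x. mangoldt d / real d) \<le> ln x + 4"
proof -
  have "real x * (\<Sum>d=1..x. mangoldt d / real d) = (\<Sum>d=1..x. mangoldt d * (real x / real d))"
    by (simp add: sum_distrib_left mult_ac)
  also have "\<dots> \<le> (\<Sum>d=1..x. mangoldt d * (real (x div d) + 1))"
  proof (intro sum_mono mult_left_mono)
    show "real x / real d \<le> real (x div d) + 1" if "d \<in> {1..x}" for d
      using divide_less_Suc_div[of d x] that by simp
  qed (simp add: mangoldt_nonneg)
  also have "\<dots> = ln (fact x) + chebyshev_psi x"
    using sum_mangoldt_floor[of x] by (simp add: distrib_left sum.distrib chebyshev_psi_def)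
  also have "\<dots> \<le> real x * (ln x + 4)"
    using ln_fact_le[of x] chebyshev_psi_le[of x] by (simp add: algebra_simps)
  finally show ?thesis using assms by simp
qed

lemma sum_mangoldt_over_ge:
  assumes "x > 0"
  shows "ln x - 1 \<le> (\<Sum>d=1..x. mangoldt d / real d)"
proof -
  have "real x * (ln x - 1) \<le> ln (fact x)" using ln_fact_ge[of x] by (simp add: algebra_simps)
  also have "\<dots> \<le> (\<Sum>d=1..x. mangoldt d * (real x / real d))"
    unfolding sum_mangoldt_floor[symmetric]
    by (intro sum_mono mult_left_mono of_nat_div_le_of_nat) (simp add: mangoldt_nonneg)
  also have "\<dots> = real x * (\<Sum>d=1..x. mangoldt d / real d)"
    by (simp add: sum_distrib_left mult_ac)
  finally show ?thesis using assms by simp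
qed

text \<open>
  The general term is at most the difference \<open>2 / sqrt (p - 1) - 2 / sqrt p\<close>, so the sum telescopes.
\<close>

lemma sum_sqrt_over_square_le: "(\<Sum>p=2..x. sqrt p / (real p)\<^sup>2) \<le> 2"
proof -
  have "(\<Sum>p=2..x. sqrt p / (real p)\<^sup>2) \<le> 2 - 2 / sqrt x" if "x \<ge> 1" for x :: nat
    using that
  proof (induction x rule: dec_induct)
    case base
    then show ?case by simp
  next
    case (step y)
    define a b where "a = sqrt (real y)" and "b = sqrt (real (Suc y))"
    have ab: "0 < a" "a \<le> b" "b\<^sup>2 = a\<^sup>2 + 1" "real (Suc y) = b\<^sup>2"
      using step by (auto simp: a_def b_def)
    have "b * (a * (a + b)) \<le> b * (b * (b + b))" using ab by (intro mult_mono) auto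
    moreover have "(b - a) * (a + b) = 1" using ab by (simp add: power2_eq_square algebra_simps)
    then have "b - a = 1 / (a + b)" using ab by (simp add: eq_divide_eq)
    then have "1 / a - 1 / b = 1 / (b * (a * (a + b)))" using ab by (simp add: diff_frac_eq mult_ac)
    ultimately have "1 / a - 1 / b \<ge> 1 / (b * (b * (b + b)))"
      using ab by (simp add: frac_le)
    also have "1 / (b * (b * (b + b))) = (b / b ^ 4) / 2"
    proof -
      have "b > 0" "b ^ 4 = b * (b * (b * b))" using ab by (simp_all add: eval_nat_numeral)
      then show ?thesis by (simp add: field_simps)
    qed
    finally have "b / (b\<^sup>2)\<^sup>2 \<le> 2 / a - 2 / b" by simp
    moreover have "sqrt (real (Suc y)) / (real (Suc y))\<^sup>2 = b / (b\<^sup>2)\<^sup>2"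
      using ab(4) by (simp add: b_def)
    ultimately show ?case using step unfolding a_def b_def by simp
  qed
  from this[of x] show ?thesis
    using order_trans[of _ "2 - 2 / sqrt x" 2] by (cases "x \<ge> 1") auto
qed

text \<open>
  Only proper prime powers contribute. For a fixed prime \<open>p\<close> they form a geometric series of
  size \<open>ln p / p\<^sup>2\<close>, and \<open>ln p \<le> 2 * sqrt p\<close> makes the sum over \<open>p\<close> converge. This lets the von Mangoldt
  function detect primes.
\<close>

lemma sum_mangoldt_nonprime_le: "(\<Sum>m | m \<in> {1..x} \<and> \<not> prime m. mangoldt m / real m) \<le> 8"
proof -
  define P where "P = {p. prime p \<and> p \<le> x}"
  have P: "P \<subseteq> {2..x}" "finite P"
    using prime_ge_2_nat by (auto simp: P_def)
  let ?S = "{m \<in> {1..x}. \<not> prime m \<and> primepow m}"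
  have "(\<Sum>m | m \<in> {1..x} \<and> \<not> prime m. mangoldt m / real m) = (\<Sum>m\<in>?S. mangoldt m / real m)"
    by (rule sum.mono_neutral_right) (auto simp: mangoldt_def)
  also have "\<dots> \<le> (\<Sum>m\<in>(\<lambda>(p,k). p ^ k) ` (P \<times> {2..x}). mangoldt m / real m)"
  proof (rule sum_mono2)
    show "?S \<subseteq> (\<lambda>(p,k). p ^ k) ` (P \<times> {2..x})"
    proof
      fix m assume m: "m \<in> ?S"
      then obtain p k where pk: "prime p" "k > 0" "m = p ^ k" by (auto simp: primepow_def)
      with m have "k \<noteq> 1" by auto
      with pk have k: "k \<ge> 2" by simp
      have "p \<le> p ^ k" using pk self_le_power[of p k] prime_gt_0_nat[of p] by simp
      moreover have "k < p ^ k" using prime_gt_1_nat[OF pk(1)] by (intro power_gt_expt) simp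
      ultimately have "(p, k) \<in> P \<times> {2..x}" using m pk k by (auto simp: P_def)
      then show "m \<in> (\<lambda>(p,k). p ^ k) ` (P \<times> {2..x})" using pk by force
    qed
  qed (use P in \<open>auto simp: mangoldt_nonneg\<close>)
  also have "\<dots> \<le> (\<Sum>(p,k)\<in>P \<times> {2..x}. mangoldt (p ^ k) / real (p ^ k))"
    using sum_image_le[of "P \<times> {2..x}" "\<lambda>m. mangoldt m / real m" "\<lambda>(p,k). p ^ k"] P
    by (simp add: mangoldt_nonneg case_prod_unfold o_def)
  also have "\<dots> = (\<Sum>p\<in>P. \<Sum>k=2..x. mangoldt (p ^ k) / real (p ^ k))"
    using P by (simp add: sum.cartesian_product)
  also have "\<dots> \<le> (\<Sum>p\<in>P. 4 * (sqrt p / (real p)\<^sup>2))"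
  proof (rule sum_mono)
    fix p assume "p \<in> P"
    then have p: "prime p" "p \<ge> 2" by (auto simp: P_def prime_ge_2_nat)
    have geo: "(\<Sum>k=2..x. (1 / real p) ^ k) \<le> 2 / (real p)\<^sup>2"
    proof (cases "x \<ge> 2")
      case True
      define q where "q = 1 / real p"
      have q: "0 < q" "q \<le> 1/2" using p by (auto simp: q_def field_simps)
      have "(\<Sum>k=2..x. q ^ k) = (q ^ 2 - q ^ Suc x) / (1 - q)"
        using q True by (subst sum_gp) (auto simp: field_simps)
      also have "\<dots> \<le> q ^ 2 / (1 - q)" using q by (intro divide_right_mono) auto
      also have "\<dots> \<le> q ^ 2 / (1 / 2)" using q by (intro divide_left_mono) auto
      finally show ?thesis by (simp add: q_def power_divide)
    qed simp
    have "(\<Sum>k=2..x. mangoldt (p ^ k) / real (p ^ k)) = ln p * (\<Sum>k=2..x. (1 / real p) ^ k)"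
      using p unfolding sum_distrib_left
      by (intro sum.cong) (auto simp: power_divide)
    also have "\<dots> \<le> ln p * (2 / (real p)\<^sup>2)" using geo p by (intro mult_left_mono) auto
    also have "ln p \<le> 2 * sqrt p"
    proof -
      have "ln (sqrt p) \<le> sqrt p - 1" using p by (intro ln_le_minus_one) simp
      then show ?thesis using p by (simp add: ln_sqrt)
    qed
    then have "ln p * (2 / (real p)\<^sup>2) \<le> (2 * sqrt p) * (2 / (real p)\<^sup>2)"
      by (intro mult_right_mono) auto
    finally show "(\<Sum>k=2..x. mangoldt (p ^ k) / real (p ^ k)) \<le> 4 * (sqrt p / (real p)\<^sup>2)" by simp
  qed
  also have "\<dots> \<le> (\<Sum>p=2..x. 4 * (sqrt p / (real p)\<^sup>2))"
    using P by (intro sum_mono2) auto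
  also have "\<dots> \<le> 4 * 2"
    unfolding sum_distrib_left[symmetric] using sum_sqrt_over_square_le by (intro mult_left_mono) auto
  finally show ?thesis by simp
qed

section \<open>The Moebius function\<close>

lemma sum_divisors_prime_power_mult:
  fixes f :: "nat \<Rightarrow> 'a::comm_monoid_add"
  assumes p: "prime p" and m: "\<not> p dvd m"
  shows "(\<Sum>d | d dvd p ^ k * m. f d) = (\<Sum>i\<le>k. \<Sum>e | e dvd m. f (p ^ i * e))"
proof -
  have m0: "m > 0" using m by (auto intro: gr0I)
  have fin: "finite {e. e dvd m}" using m0 by simp
  have p0: "p > 0" using p prime_gt_0_nat by blast
  have "(\<Sum>i\<le>k. \<Sum>e | e dvd m. f (p ^ i * e)) = (\<Sum>(i,e)\<in>{..k} \<times> {e. e dvd m}. f (p ^ i * e))"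
    using fin by (simp add: sum.cartesian_product)
  also have "\<dots> = (\<Sum>d | d dvd p ^ k * m. f d)"
  proof (rule sum.reindex_bij_witness[of _ "\<lambda>d. (multiplicity p d, d div p ^ multiplicity p d)" "\<lambda>(i,e). p ^ i * e"])
    fix z assume "z \<in> {..k} \<times> {e. e dvd m}"
    then obtain i e where z: "z = (i, e)" "i \<le> k" "e dvd m" by auto
    then have ne: "\<not> p dvd e" using m dvd_trans by blast
    have "multiplicity p (p ^ i * e) = i"
      using p ne by (intro multiplicity_eqI) (auto simp: p0)
    then show "(multiplicity p (case z of (i, e) \<Rightarrow> p ^ i * e),
        (case z of (i, e) \<Rightarrow> p ^ i * e) div p ^ multiplicity p (case z of (i, e) \<Rightarrow> p ^ i * e)) = z"
      using z p0 by simp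
    show "(case z of (i, e) \<Rightarrow> p ^ i * e) \<in> {d. d dvd p ^ k * m}"
      using z by (auto intro!: mult_dvd_mono le_imp_power_dvd)
    show "f (case z of (i, e) \<Rightarrow> p ^ i * e) = (case z of (i, e) \<Rightarrow> f (p ^ i * e))"
      by (simp add: z)
  next
    fix d assume "d \<in> {d. d dvd p ^ k * m}"
    then have d: "d dvd p ^ k * m" by simp
    then have d0: "d > 0" using p0 m0 by (auto intro: gr0I)
    obtain e where e: "d = p ^ multiplicity p d * e" "\<not> p dvd e"
      using multiplicity_decompose'[of d p] d0 p by (metis neq0_conv not_prime_unit)
    have "p ^ multiplicity p d dvd p ^ k * m" using d multiplicity_dvd dvd_trans by blast
    moreover have cop: "coprime (p ^ j) m" for j
      using prime_imp_coprime[OF p m] by simp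
    ultimately have "p ^ multiplicity p d dvd p ^ k"
      using cop by (simp add: coprime_dvd_mult_left_iff)
    then have "multiplicity p d \<le> k"
      using p prime_gt_1_nat[OF p] by (simp add: power_dvd_imp_le)
    moreover have "e dvd m"
    proof -
      have "e dvd p ^ k * m" using d e(1) by (metis dvd_mult_right)
      moreover have "coprime e (p ^ k)"
        using prime_imp_coprime[OF p e(2)] by (simp add: coprime_commute)
      ultimately show ?thesis by (simp add: coprime_dvd_mult_right_iff)
    qed
    moreover have "d div p ^ multiplicity p d = e" using e(1) p0
      by (metis nonzero_mult_div_cancel_left power_eq_0_iff neq0_conv)
    ultimately show "(multiplicity p d, d div p ^ multiplicity p d) \<in> {..k} \<times> {e. e dvd m}"
      "(case (multiplicity p d, d div p ^ multiplicity p d) of (i, e) \<Rightarrow> p ^ i * e) = d"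
      using e(1) by auto
  qed
  finally show ?thesis by simp
qed

definition moebius :: "nat \<Rightarrow> real" where
  "moebius n = (if squarefree n then (-1) ^ card (prime_factors n) else 0)"

lemma abs_moebius_le: "\<bar>moebius n\<bar> \<le> 1"
  by (simp add: moebius_def power_abs)

lemma moebius_prime_mult:
  assumes "prime p" "\<not> p dvd e"
  shows "moebius (p * e) = - moebius e"
proof -
  have e0: "e > 0" using assms by (auto intro: gr0I)
  have cop: "coprime p e" using assms prime_imp_coprime by blast
  have sq: "squarefree (p * e) \<longleftrightarrow> squarefree e"
    using squarefree_mult_coprime[OF cop] squarefree_prime[OF assms(1)]
      squarefree_mono[of e "p * e"] by (auto dest: squarefree_multD)
  have "prime_factors (p * e) = insert p (prime_factors e)"
    using assms e0 by (subst prime_factors_product) (auto simp: prime_factorization_prime)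
  moreover have "p \<notin> prime_factors e" using assms by auto
  ultimately show ?thesis by (simp add: moebius_def sq)
qed

text \<open>
  For a prime power \<open>p ^ k\<close> dividing \<open>n\<close> exactly, the divisors containing \<open>p\<close> exactly once cancel those
  prime to \<open>p\<close>, and \<open>p\<^sup>2\<close> divides all others.
\<close>

lemma sum_moebius_divisors:
  assumes "n > 0"
  shows "(\<Sum>d | d dvd n. moebius d) = (if n = 1 then 1 else 0)"
proof (cases "n = 1")
  case True
  then show ?thesis by (simp add: moebius_def)
next
  case False
  then obtain p where p: "prime p" "p dvd n" using prime_factor_nat by blast
  obtain m where m: "n = p ^ multiplicity p n * m" "\<not> p dvd m"
    using multiplicity_decompose'[of n p] assms p by (metis neq0_conv not_prime_unit)
  define k where "k = multiplicity p n"
  have k: "k \<ge> 1" using p assms m unfolding k_def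
    by (metis Suc_leI One_nat_def mult_1 neq0_conv power_0)
  have "(\<Sum>d | d dvd n. moebius d) = (\<Sum>i\<le>k. \<Sum>e | e dvd m. moebius (p ^ i * e))"
    using sum_divisors_prime_power_mult[OF p(1) m(2), of moebius k] m(1) by (simp add: k_def)
  also have "\<dots> = (\<Sum>i\<in>{0,1}. \<Sum>e | e dvd m. moebius (p ^ i * e))"
  proof (rule sum.mono_neutral_right)
    show "\<forall>i\<in>{..k} - {0,1}. (\<Sum>e | e dvd m. moebius (p ^ i * e)) = 0"
    proof (intro ballI sum.neutral)
      fix i e assume i: "i \<in> {..k} - {0,1}"
      then have "p ^ 2 dvd p ^ i * e" by (intro dvd_mult2 le_imp_power_dvd) auto
      then have "\<not> squarefree (p ^ i * e)"
        using p not_prime_unit unfolding squarefree_def by blast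
      then show "moebius (p ^ i * e) = 0" by (simp add: moebius_def)
    qed
  qed (use k in auto)
  also have "\<dots> = (\<Sum>e | e dvd m. moebius e) + (\<Sum>e | e dvd m. moebius (p * e))"
    by simp
  also have "(\<Sum>e | e dvd m. moebius (p * e)) = (\<Sum>e | e dvd m. - moebius e)"
    using m(2) p(1) by (intro sum.cong refl moebius_prime_mult) auto
  finally show ?thesis using False by (simp add: sum_negf)
qed

text \<open>
  Moebius inversion of \<open>ln n = (\<Sum>d | d dvd n. mangoldt d)\<close>: expanding \<open>ln (n div d)\<close> and exchanging the sums
  leaves \<open>mangoldt n\<close> for the sum of \<open>moebius d * ln (n div d)\<close>, and the part \<open>ln n\<close> of \<open>ln (n div d)\<close>
  contributes nothing.
\<close>

lemma sum_moebius_ln_divisors: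
  assumes n: "n > 0"
  shows "(\<Sum>d | d dvd n. moebius d * ln d) = - mangoldt n"
proof -
  let ?D = "{d. d dvd n}"
  have fin: "finite {d. d dvd m}" if "m dvd n" for m using that n
    by (metis dvd_pos_nat finite_divisors_nat)
  have fin': "finite {d. d dvd n div m}" if "m dvd n" for m
    using that by (intro fin) (metis dvd_div_mult_self dvd_triv_left)
  have "(\<Sum>d\<in>?D. moebius d * ln (n div d)) = (\<Sum>d\<in>?D. \<Sum>e | e dvd n div d. moebius d * mangoldt e)"
  proof (rule sum.cong[OF refl])
    fix d assume "d \<in> ?D"
    then have "n div d \<noteq> 0" using n by (auto simp: dvd_div_eq_0_iff)
    then show "moebius d * ln (n div d) = (\<Sum>e | e dvd n div d. moebius d * mangoldt e)"
      using mangoldt_sum[of "n div d", where ?'a = real] by (simp add: sum_distrib_left[symmetric])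
  qed
  also have "\<dots> = (\<Sum>(d,e)\<in>(SIGMA d:?D. {e. e dvd n div d}). moebius d * mangoldt e)"
    using fin' fin[of n] by (subst sum.Sigma) auto
  also have "\<dots> = (\<Sum>(e,d)\<in>(SIGMA e:?D. {d. d dvd n div e}). moebius d * mangoldt e)"
  proof (rule sum.reindex_bij_witness[of _ prod.swap prod.swap])
    have sym: "e dvd n \<and> d dvd n div e" if "d dvd n" "e dvd n div d" for d e
    proof -
      from that n have "d \<noteq> 0" by (auto intro: gr0I)
      with that have "d * e dvd n" by (metis dvd_div_iff_mult mult.commute)
      then have "e dvd n" "e * d dvd n" by (auto simp: mult.commute elim: dvd_mult_left)
      moreover from this n have "e \<noteq> 0" by auto
      ultimately show ?thesis by (metis dvd_div_iff_mult mult.commute)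
    qed
    show "prod.swap z \<in> (SIGMA e:?D. {d. d dvd n div e})" if "z \<in> (SIGMA d:?D. {e. e dvd n div d})" for z
      using that sym by (cases z) auto
    show "prod.swap z \<in> (SIGMA e:?D. {d. d dvd n div e})" if "z \<in> (SIGMA d:?D. {e. e dvd n div d})" for z
      using that sym by (cases z) auto
  qed (auto simp: case_prod_unfold)
  also have "\<dots> = (\<Sum>e\<in>?D. \<Sum>d | d dvd n div e. moebius d * mangoldt e)"
    using fin' fin[of n] by (subst sum.Sigma) auto
  also have "\<dots> = (\<Sum>e\<in>?D. if e = n then mangoldt n else 0)"
  proof (rule sum.cong[OF refl])
    fix e assume "e \<in> ?D"
    then have e: "e dvd n" by simp
    then have "n div e > 0" using n by (auto simp: dvd_div_eq_0_iff)
    moreover have "n div e = 1 \<longleftrightarrow> e = n" using e n by (auto simp: dvd_div_eq_iff)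
    ultimately show "(\<Sum>d | d dvd n div e. moebius d * mangoldt e) = (if e = n then mangoldt n else 0)"
      using sum_moebius_divisors[of "n div e"] by (simp add: sum_distrib_right[symmetric])
  qed
  also have "\<dots> = mangoldt n" using fin[of n] by (simp add: sum.delta)
  finally have 1: "(\<Sum>d\<in>?D. moebius d * ln (n div d)) = mangoldt n" .
  have "(\<Sum>d\<in>?D. moebius d * ln (n div d)) = (\<Sum>d\<in>?D. moebius d * ln n - moebius d * ln d)"
  proof (rule sum.cong[OF refl])
    fix d assume "d \<in> ?D"
    then have "d dvd n" "d > 0" using n by (auto intro: gr0I)
    then show "moebius d * ln (n div d) = moebius d * ln n - moebius d * ln d"
      using n by (simp add: real_of_nat_div ln_div algebra_simps)
  qed
  also have "\<dots> = ln n * (\<Sum>d\<in>?D. moebius d) - (\<Sum>d\<in>?D. moebius d * ln d)"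
    by (simp add: sum_subtractf sum_distrib_left mult.commute)
  also have "ln n * (\<Sum>d\<in>?D. moebius d) = 0"
    using sum_moebius_divisors[OF n] by simp
  finally show ?thesis using 1 by simp
qed

section \<open>Non-vanishing for real characters\<close>

lemma sum_alternating_powers_nonneg:
  assumes "x \<in> {-1, 0, 1::real}"
  shows "0 \<le> (\<Sum>i\<le>k. x ^ i)" and "even k \<Longrightarrow> 1 \<le> (\<Sum>i\<le>k. x ^ i)"
proof -
  have "0 \<le> (\<Sum>i\<le>k. x ^ i) \<and> (even k \<longrightarrow> 1 \<le> (\<Sum>i\<le>k. x ^ i))"
  proof (cases "x = -1")
    case True
    have "(\<Sum>i\<le>k. (-1::real) ^ i) = (if even k then 1 else 0)" by (induction k) auto
    then show ?thesis using True by simp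
  next
    case False
    then have "x \<ge> 0" using assms by auto
    then have "x ^ 0 \<le> (\<Sum>i\<le>k. x ^ i)" by (intro member_le_sum) auto
    then show ?thesis by simp
  qed
  then show "0 \<le> (\<Sum>i\<le>k. x ^ i)" "even k \<Longrightarrow> 1 \<le> (\<Sum>i\<le>k. x ^ i)" by auto
qed

text \<open>
  The divisor sum of a multiplicative function is multiplicative, and on a prime power
  \<open>p ^ k\<close> it is \<open>1 + r p + \<dots> + r p ^ k\<close>, which is nonnegative for \<open>r p \<in> {-1, 0, 1}\<close> and at least \<open>1\<close> if \<open>k\<close> is
  even. In a square all exponents are even.
\<close>

lemma real_character_divisor_sum:
  fixes r :: "nat \<Rightarrow> real"
  assumes mult: "\<And>a b. r (a * b) = r a * r b" and vals: "\<And>a. r a \<in> {-1, 0, 1}" and one: "r 1 = 1"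
    and m: "m > 0"
  shows "0 \<le> (\<Sum>d | d dvd m. r d)" and "m = l\<^sup>2 \<Longrightarrow> 1 \<le> (\<Sum>d | d dvd m. r d)"
proof -
  have pow: "r (a ^ i) = r a ^ i" for a i
    using one by (induction i) (auto simp: mult)
  have "0 \<le> (\<Sum>d | d dvd m. r d) \<and> (\<forall>l. m = l\<^sup>2 \<longrightarrow> 1 \<le> (\<Sum>d | d dvd m. r d))"
    using m
  proof (induction m rule: less_induct)
    case (less m)
    show ?case
    proof (cases "m = 1")
      case True
      then have "(\<Sum>d | d dvd m. r d) = 1" using one by simp
      then show ?thesis by (intro conjI allI impI) linarith+
    next
      case False
      then obtain p where p: "prime p" "p dvd m" using prime_factor_nat by blast
      define k where "k = multiplicity p m"
      obtain n where n: "m = p ^ k * n" "\<not> p dvd n"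
        using multiplicity_decompose'[of m p] less.prems p unfolding k_def
        by (metis neq0_conv not_prime_unit)
      have k: "k > 0" using p n by (auto intro: gr0I)
      have n0: "n > 0" using n less.prems by (auto intro: gr0I)
      have "p ^ k > 1" using one_less_power[OF prime_gt_1_nat[OF p(1)] k] .
      then have nm: "n < m" using n n0 by simp
      have eq: "(\<Sum>d | d dvd m. r d) = (\<Sum>i\<le>k. r p ^ i) * (\<Sum>e | e dvd n. r e)"
        unfolding n(1) sum_divisors_prime_power_mult[OF p(1) n(2)]
        by (simp add: mult pow sum_product)
      note IH = less.IH[OF nm n0]
      have "1 \<le> (\<Sum>d | d dvd m. r d)" if l: "m = l\<^sup>2" for l
      proof -
        have "l \<noteq> 0" using l less.prems by (auto intro: gr0I)
        then have kl: "k = 2 * multiplicity p l"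
          using p unfolding k_def l by (simp add: prime_elem_multiplicity_power_distrib)
        obtain l' where l': "l = p ^ multiplicity p l * l'" using multiplicity_dvd by (metis dvdE)
        then have "p ^ k * n = p ^ k * l'\<^sup>2"
          using l n(1) unfolding kl by (metis power_mult power_mult_distrib mult.commute)
        then have "n = l'\<^sup>2" using p prime_gt_0_nat[OF p(1)] by simp
        then have "1 \<le> (\<Sum>e | e dvd n. r e)" using IH by blast
        moreover have "1 \<le> (\<Sum>i\<le>k. r p ^ i)"
          using sum_alternating_powers_nonneg(2)[OF vals] kl by simp
        ultimately show ?thesis unfolding eq
          using mult_mono[of 1 "\<Sum>i\<le>k. r p ^ i" 1 "\<Sum>e | e dvd n. r e"] by simp
      qed
      moreover have "0 \<le> (\<Sum>d | d dvd m. r d)"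
        unfolding eq using sum_alternating_powers_nonneg(1)[OF vals] IH by simp
      ultimately show ?thesis by blast
    qed
  qed
  then show "0 \<le> (\<Sum>d | d dvd m. r d)" "m = l\<^sup>2 \<Longrightarrow> 1 \<le> (\<Sum>d | d dvd m. r d)" by auto
qed

text \<open>
  The inequality of the arithmetic and geometric mean, applied to the pairs \<open>(y ^ i)\<^sup>2\<close> and
  \<open>(y ^ (n - 1 - i))\<^sup>2\<close>. Working with \<open>y\<^sup>2\<close> avoids half-integral exponents.
\<close>

lemma geometric_sum_ge:
  fixes y :: real
  assumes "0 < y"
  shows "real n * y ^ (n - 1) \<le> (\<Sum>i<n. (y\<^sup>2) ^ i)"
proof -
  have "2 * (\<Sum>i<n. (y\<^sup>2) ^ i) = (\<Sum>i<n. (y ^ i)\<^sup>2 + (y ^ (n - 1 - i))\<^sup>2)"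
  proof -
    have "(\<Sum>i<n. (y ^ (n - 1 - i))\<^sup>2) = (\<Sum>i<n. (y ^ i)\<^sup>2)"
      using sum.nat_diff_reindex[of "\<lambda>i. (y ^ i)\<^sup>2" n] by simp
    then show ?thesis by (simp add: sum.distrib power_mult[symmetric] mult.commute)
  qed
  also have "\<dots> \<ge> (\<Sum>i<n. 2 * y ^ (n - 1))"
  proof (rule sum_mono)
    fix i assume "i \<in> {..<n}"
    then have "y ^ (n - 1) = y ^ i * y ^ (n - 1 - i)" by (simp add: power_add[symmetric])
    then show "2 * y ^ (n - 1) \<le> (y ^ i)\<^sup>2 + (y ^ (n - 1 - i))\<^sup>2"
      using sum_squares_bound[of "y ^ i" "y ^ (n - 1 - i)"] by simp
  qed
  finally show ?thesis by simp
qed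

text \<open>
  With \<open>S n = 1 + x + \<dots> + x ^ (n - 1)\<close> the weight is \<open>(1 / n - x ^ n / S n) / (1 - x)\<close>, and the difference of two
  consecutive weights is \<open>1 / (n * (n + 1)) - x ^ n / (S n * S (n + 1))\<close> up to the factor \<open>1 - x\<close>. It is
  nonnegative by the preceding lower bound for \<open>S\<close>.
\<close>

lemma lambert_weight_decreasing:
  fixes x :: real
  assumes x: "0 < x" "x < 1" and n: "n \<ge> 1"
  defines "b \<equiv> \<lambda>n. 1 / (real n * (1 - x)) - x ^ n / (1 - x ^ n)"
  shows "b (Suc n) \<le> b n" and "0 \<le> b n"
proof -
  define y where "y = sqrt x"
  have y: "0 < y" "y < 1" "x = y\<^sup>2" using x by (auto simp: y_def)
  define S where "S n = (\<Sum>i<n. x ^ i)" for n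
  have S: "1 - x ^ m = (1 - x) * S m" for m
    unfolding S_def using one_diff_power_eq[of x m] by simp
  have Sge: "real m * y ^ (m - 1) \<le> S m" for m
    using geometric_sum_ge[OF y(1), of m] by (simp add: S_def y)
  have Spos: "S m > 0" if "m \<ge> 1" for m
  proof -
    have "0 < real m * y ^ (m - 1)" using that y by simp
    then show ?thesis using Sge[of m] by linarith
  qed
  have b: "b m = (1 / real m - x ^ m / S m) / (1 - x)" if "m \<ge> 1" for m
    by (simp add: b_def S diff_divide_distrib mult.commute)
  have frac: "a / P \<le> 1 / Q" if "a * Q \<le> P" "P > 0" "Q > 0" for a P Q :: real
    using that by (simp add: field_simps)
  have SS': "S (Suc n) = 1 + x * S n"
    unfolding S_def by (subst sum.lessThan_Suc_shift) (simp add: sum_distrib_left)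
  have "x ^ n * (real n * real (Suc n)) \<le> S n * S (Suc n)"
  proof -
    have "x ^ n * (real n * real (Suc n)) = (real n * real (Suc n)) * y ^ (2 * n)"
      by (simp add: y power_mult[symmetric])
    also have "\<dots> \<le> (real n * real (Suc n)) * y ^ ((n - 1) + n)"
      using y by (intro mult_left_mono power_decreasing) auto
    also have "\<dots> = (real n * y ^ (n - 1)) * (real (Suc n) * y ^ n)"
      by (simp add: power_add)
    also have "\<dots> \<le> S n * S (Suc n)"
      using Sge[of n] Sge[of "Suc n"] y Spos[OF n] by (intro mult_mono) auto
    finally show ?thesis .
  qed
  then have "x ^ n / (S n * S (Suc n)) \<le> 1 / (real n * real (Suc n))"
    using n Spos[OF n] Spos[of "Suc n"] by (intro frac) auto
  also have "1 / (real n * real (Suc n)) = 1 / real n - 1 / real (Suc n)"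
    using n by (simp add: field_simps)
  finally have le: "x ^ n / (S n * S (Suc n)) \<le> 1 / real n - 1 / real (Suc n)" .
  have "x ^ n / S n - x ^ Suc n / S (Suc n) = x ^ n * (S (Suc n) - x * S n) / (S n * S (Suc n))"
    using Spos[OF n] Spos[of "Suc n"] by (simp add: field_simps)
  also have "S (Suc n) - x * S n = 1" by (simp add: SS')
  finally have eq: "x ^ n / S n - x ^ Suc n / S (Suc n) = x ^ n / (S n * S (Suc n))" by simp
  have "1 / real (Suc n) - x ^ Suc n / S (Suc n) \<le> 1 / real n - x ^ n / S n"
    using le eq by linarith
  then show "b (Suc n) \<le> b n"
    unfolding b[OF n] b[of "Suc n", simplified] using x by (intro divide_right_mono) auto
  have "real n * x ^ n \<le> S n"
  proof -
    have "x ^ n = y ^ (2 * n)" by (simp add: y power_mult[symmetric])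
    also have "\<dots> \<le> y ^ (n - 1)" using y by (intro power_decreasing) auto
    finally have "real n * x ^ n \<le> real n * y ^ (n - 1)" by (intro mult_left_mono) auto
    then show ?thesis using Sge[of n] by linarith
  qed
  then have "x ^ n / S n \<le> 1 / real n" using n Spos[OF n] by (simp add: field_simps)
  then show "0 \<le> b n" unfolding b[OF n] using x by simp
qed

lemma geometric_tail:
  fixes z :: real
  assumes "0 < z" "z < 1"
  shows "z / (1 - z) = (\<Sum>e=1..q. z ^ e) + z ^ Suc q / (1 - z)"
  using assms by (induction q) (auto simp: field_simps)

text \<open>
  Monsky's argument. Consider the Lambert series \<open>f x = (\<Sum>n. r n * x ^ n / (1 - x ^ n))\<close>. Expanding the
  geometric series shows that the coefficients of \<open>f\<close> are the divisor sums of \<open>r\<close>, so that \<open>f x\<close> is at least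
  the sum of \<open>x ^ k\<^sup>2\<close>, which is unbounded as \<open>x\<close> tends to \<open>1\<close>. If \<open>(\<Sum>n. r n / n) = 0\<close>, then subtracting
  \<open>(\<Sum>n. r n / (n * (1 - x)))\<close> changes nothing, and what remains is a sum of \<open>r\<close> with decreasing
  weights, hence bounded uniformly in \<open>x\<close>. All series are cut off at \<open>M\<close>, with error terms that vanish
  as \<open>M\<close> grows; the assumption \<open>zero\<close> expresses the vanishing of the series through its tails.
\<close>

lemma real_character_L_ne_0:
  fixes r :: "nat \<Rightarrow> real"
  assumes mult: "\<And>a b. r (a * b) = r a * r b" and vals: "\<And>a. r a \<in> {-1, 0, 1}" and one: "r 1 = 1"
    and C: "\<And>m. \<bar>\<Sum>k=1..m. r k\<bar> \<le> C"
    and zero: "\<And>m. \<bar>\<Sum>k=1..m. r k / real k\<bar> \<le> C / (real m + 1)"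
  shows False
proof -
  define c where "c m = (\<Sum>d | d dvd m. r d)" for m
  have main: "(\<Sum>k=1..K. x ^ (k\<^sup>2)) \<le> C + C / ((real M + 1) * (1 - x)) + real M * x ^ M / (1 - x)"
    if x: "0 < x" "x < 1" and KM: "K\<^sup>2 \<le> M" for x :: real and K M :: nat
  proof -
    define b where "b n = 1 / (real n * (1 - x)) - x ^ n / (1 - x ^ n)" for n :: nat
    have xn: "0 < x ^ n" "x ^ n < 1" "x ^ n \<le> x" if "n \<ge> 1" for n
      using x that power_decreasing[of 1 n x] by (auto simp: power_less_one_iff)
    have "(\<Sum>k=1..K. x ^ (k\<^sup>2)) = (\<Sum>m\<in>(\<lambda>k. k\<^sup>2) ` {1..K}. x ^ m)"
      by (subst sum.reindex) (auto simp: inj_on_def)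
    also have "\<dots> \<le> (\<Sum>m\<in>(\<lambda>k. k\<^sup>2) ` {1..K}. c m * x ^ m)"
    proof (rule sum_mono)
      fix m assume "m \<in> (\<lambda>k::nat. k\<^sup>2) ` {1..K}"
      then obtain l where "m = l\<^sup>2" "m > 0" by auto
      then have "1 \<le> c m" unfolding c_def
        using real_character_divisor_sum(2)[OF mult vals one] by blast
      then show "x ^ m \<le> c m * x ^ m" using x by simp
    qed
    also have "\<dots> \<le> (\<Sum>m=1..M. c m * x ^ m)"
    proof (rule sum_mono2)
      show "(\<lambda>k. k\<^sup>2) ` {1..K} \<subseteq> {1..M}"
      proof
        fix m assume "m \<in> (\<lambda>k::nat. k\<^sup>2) ` {1..K}"
        then obtain k where k: "m = k\<^sup>2" "1 \<le> k" "k \<le> K" by auto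
        then have "k\<^sup>2 \<le> K\<^sup>2" by (intro power_mono) auto
        then have "k\<^sup>2 \<le> M" using KM by (rule order_trans)
        then show "m \<in> {1..M}" using k by (simp add: Suc_le_eq)
      qed
      show "0 \<le> c m * x ^ m" if "m \<in> {1..M} - (\<lambda>k. k\<^sup>2) ` {1..K}" for m
        using real_character_divisor_sum(1)[OF mult vals one, of m] that x by (simp add: c_def)
    qed simp
    also have "\<dots> = (\<Sum>m=1..M. \<Sum>d | d dvd m. r d * x ^ (d * (m div d)))"
      unfolding c_def sum_distrib_right by (intro sum.cong) auto
    also have "\<dots> = (\<Sum>d=1..M. \<Sum>e=1..M div d. r d * x ^ (d * e))"
      by (rule sum_divisors_swap)
    also have "\<dots> = (\<Sum>d=1..M. r d * (x ^ d / (1 - x ^ d)) - r d * ((x ^ d) ^ Suc (M div d) / (1 - x ^ d)))"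
    proof (rule sum.cong[OF refl])
      fix d assume "d \<in> {1..M}"
      then have d: "d \<ge> 1" by simp
      show "(\<Sum>e=1..M div d. r d * x ^ (d * e)) =
          r d * (x ^ d / (1 - x ^ d)) - r d * ((x ^ d) ^ Suc (M div d) / (1 - x ^ d))"
        using geometric_tail[OF xn(1,2)[OF d], of "M div d"]
        by (simp only: sum_distrib_left[symmetric] power_mult right_diff_distrib[symmetric]) simp
    qed
    also have "\<dots> \<le> (\<Sum>d=1..M. r d * (x ^ d / (1 - x ^ d)) + x ^ M / (1 - x))"
    proof (rule sum_mono)
      fix d assume "d \<in> {1..M}"
      then have d: "d \<ge> 1" by simp
      have "M \<le> d * Suc (M div d)"
        using d dividend_less_div_times[of d M] by (simp add: mult.commute)
      then have "(x ^ d) ^ Suc (M div d) \<le> x ^ M"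
        unfolding power_mult[symmetric] using x by (intro power_decreasing) auto
      then have "(x ^ d) ^ Suc (M div d) / (1 - x ^ d) \<le> x ^ M / (1 - x)"
        using xn[OF d] x by (intro frac_le) auto
      moreover have "0 \<le> (x ^ d) ^ Suc (M div d) / (1 - x ^ d)" using xn[OF d] by simp
      moreover have "r d * u - r d * w \<le> r d * u + W" if "w \<le> W" "0 \<le> w" for u w W
        using vals[of d] that by auto
      ultimately show "r d * (x ^ d / (1 - x ^ d)) - r d * ((x ^ d) ^ Suc (M div d) / (1 - x ^ d))
          \<le> r d * (x ^ d / (1 - x ^ d)) + x ^ M / (1 - x)" by blast
    qed
    also have "\<dots> = (\<Sum>d=1..M. r d * (x ^ d / (1 - x ^ d))) + real M * x ^ M / (1 - x)"
      by (simp add: sum.distrib)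
    also have "(\<Sum>d=1..M. r d * (x ^ d / (1 - x ^ d)))
        = (\<Sum>d=1..M. r d / real d) / (1 - x) - (\<Sum>d=1..M. b d *\<^sub>R r d)"
      unfolding sum_divide_distrib sum_subtractf[symmetric]
      by (intro sum.cong) (auto simp: b_def algebra_simps)
    also have "\<dots> \<le> C / (real M + 1) / (1 - x) + C"
    proof -
      have "(\<Sum>d=1..M. r d / real d) / (1 - x) \<le> C / (real M + 1) / (1 - x)"
        using zero[of M] x by (intro divide_right_mono) auto
      moreover have "norm (\<Sum>d=1..M. b d *\<^sub>R r d) \<le> C * b 1"
        using C lambert_weight_decreasing[OF x] unfolding b_def[symmetric]
        by (intro norm_sum_decreasing_weights_le) auto
      moreover have "b 1 = 1" using x by (simp add: b_def field_simps)
      ultimately show ?thesis by auto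
    qed
    finally show ?thesis using x by simp
  qed
  have lim: "(\<Sum>k=1..K. x ^ (k\<^sup>2)) \<le> C" if x: "0 < x" "x < 1" for x :: real and K :: nat
  proof (rule tendsto_lowerbound)
    have "(\<lambda>M. C + C * inverse (real (Suc M)) / (1 - x) + (of_nat M * x ^ M) / (1 - x))
        \<longlonglongrightarrow> C + C * 0 / (1 - x) + 0 / (1 - x)"
      using x by (intro tendsto_intros LIMSEQ_inverse_real_of_nat powser_times_n_limit_0) auto
    then show "(\<lambda>M. C + C * inverse (real (Suc M)) / (1 - x) + (of_nat M * x ^ M) / (1 - x)) \<longlonglongrightarrow> C"
      by simp
    show "\<forall>\<^sub>F M in sequentially. (\<Sum>k=1..K. x ^ (k\<^sup>2))
        \<le> C + C * inverse (real (Suc M)) / (1 - x) + (of_nat M * x ^ M) / (1 - x)"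
      using eventually_ge_at_top[of "K\<^sup>2"]
    proof eventually_elim
      case (elim M)
      then show ?case using main[OF x elim] by (simp add: field_simps)
    qed
  qed simp
  obtain K :: nat where K: "real K > 2 * C" using reals_Archimedean2 by blast
  have C0: "C \<ge> 1" using C[of 1] one by simp
  then have K0: "K > 0" using K by (auto intro: gr0I)
  \<comment> \<open>This \<open>x\<close> is close enough to \<open>1\<close> for each of the \<open>K > 2 * C\<close> terms \<open>x ^ k\<^sup>2\<close> to be at least \<open>1 / 2\<close>.\<close>
  define x where "x = root (K\<^sup>2) (1 / 2 :: real)"
  have x: "0 < x" "x < 1" "x ^ (K\<^sup>2) = 1 / 2"
    using K0 by (auto simp: x_def real_root_lt_1_iff real_root_pow_pos2)
  have "real K * (1 / 2) = (\<Sum>k=1..K. x ^ (K\<^sup>2))" by (simp add: x)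
  also have "\<dots> \<le> (\<Sum>k=1..K. x ^ (k\<^sup>2))"
    using x by (intro sum_mono power_decreasing power_mono) auto
  also have "\<dots> \<le> C" using lim x by blast
  finally show False using K by simp
qed

section \<open>Mertens sums twisted by a character\<close>

definition twisted_mangoldt_sum :: "(nat \<Rightarrow> complex) \<Rightarrow> nat \<Rightarrow> complex" where
  "twisted_mangoldt_sum \<chi> x = (\<Sum>m=1..x. \<chi> m * mangoldt m / of_nat m)"

text \<open>
  The only facts about a non-principal Dirichlet character that the analysis needs: complete
  multiplicativity, values in the unit disc, and bounded sums over intervals.
\<close>

locale bounded_character =
  fixes \<chi> :: "nat \<Rightarrow> complex" and C :: real
  assumes mult: "\<chi> (a * b) = \<chi> a * \<chi> b"
    and one: "\<chi> 1 = 1"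
    and norm_le_1: "norm (\<chi> a) \<le> 1"
    and sum_bound: "norm (\<Sum>k=a..b. \<chi> k) \<le> C"
begin

definition L_partial :: "nat \<Rightarrow> complex" where
  "L_partial x = (\<Sum>k=1..x. \<chi> k / of_nat k)"

definition L_one :: complex where
  "L_one = lim L_partial"

lemma C_nonneg: "0 \<le> C"
  using sum_bound[of 1 0] by simp

lemma L_partial_diff:
  assumes "x \<le> y"
  shows "norm (L_partial y - L_partial x) \<le> C / (real x + 1)"
proof -
  have "{1..y} = {1..x} \<union> {Suc x..y}" "{1..x} \<inter> {Suc x..y} = {}" using assms by auto
  then have "L_partial y = L_partial x + (\<Sum>k=Suc x..y. \<chi> k / of_nat k)"
    unfolding L_partial_def by (simp only:) (rule sum.union_disjoint, auto)
  then have "L_partial y - L_partial x = (\<Sum>k=Suc x..y. (1 / real k) *\<^sub>R \<chi> k)"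
    by (simp add: scaleR_conv_of_real)
  also have "norm \<dots> \<le> C * (1 / real (Suc x))"
    by (rule norm_sum_decreasing_weights_le) (auto simp: sum_bound frac_le)
  finally show ?thesis by (simp add: add.commute)
qed

lemma L_partial_tendsto: "L_partial \<longlonglongrightarrow> L_one"
proof -
  have "Cauchy L_partial"
  proof (rule CauchyI)
    fix e :: real assume e: "e > 0"
    obtain N :: nat where N: "real N > C / e" using reals_Archimedean2 by blast
    have less: "norm (L_partial m - L_partial n) < e" if "N \<le> n" "n \<le> m" for m n
    proof -
      have "norm (L_partial m - L_partial n) \<le> C / (real n + 1)" using L_partial_diff that by blast
      also have "\<dots> < e"
      proof -
        have "C < real N * e" using N e by (simp add: divide_less_eq)
        also have "\<dots> \<le> (real n + 1) * e" using that e by (intro mult_right_mono) auto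
        finally show ?thesis by (simp add: divide_less_eq mult.commute)
      qed
      finally show ?thesis .
    qed
    show "\<exists>M. \<forall>m\<ge>M. \<forall>n\<ge>M. norm (L_partial m - L_partial n) < e"
      using less by (metis nle_le norm_minus_commute)
  qed
  then show ?thesis
    unfolding L_one_def using Cauchy_convergent convergent_LIMSEQ_iff by blast
qed

lemma L_tail: "norm (L_one - L_partial x) \<le> C / (real x + 1)"
proof (rule tendsto_upperbound)
  show "(\<lambda>y. norm (L_partial y - L_partial x)) \<longlonglongrightarrow> norm (L_one - L_partial x)"
    by (intro tendsto_intros L_partial_tendsto)
  show "\<forall>\<^sub>F y in sequentially. norm (L_partial y - L_partial x) \<le> C / (real x + 1)"
    using eventually_ge_at_top[of x] by eventually_elim (rule L_partial_diff)
qed simp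

text \<open>
  The form in which tails enter convolutions: the factor \<open>d\<close> cancels a weight \<open>1 / d\<close>.
\<close>

lemma L_tail_div:
  assumes "d > 0" "x > 0"
  shows "norm (L_one - L_partial (x div d)) \<le> C * real d / real x"
proof -
  have "norm (L_one - L_partial (x div d)) \<le> C / (real (x div d) + 1)" by (rule L_tail)
  also have "\<dots> \<le> C / (real x / real d)"
    using divide_less_Suc_div[OF assms(1), of x] assms C_nonneg by (intro divide_left_mono) auto
  finally show ?thesis by simp
qed

text \<open>
  The weight \<open>ln k / k\<close> decreases only from \<open>k = 3\<close> on, hence the separate treatment of the first two
  terms.
\<close>

lemma sum_ln_bounded: "norm (\<Sum>k=1..x. \<chi> k * ln (real k) / of_nat k) \<le> 1 + 2 * C"
proof -
  define t where "t k = \<chi> k * ln (real k) / of_nat k" for k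
  have t: "t k = (ln (real k) / real k) *\<^sub>R \<chi> k" for k
    by (simp add: t_def scaleR_conv_of_real)
  have tail: "norm (\<Sum>k=3..x. t k) \<le> C * (ln (real 3) / real 3)"
    unfolding t
  proof (rule norm_sum_decreasing_weights_le)
    show "ln (real (Suc k)) / real (Suc k) \<le> ln (real k) / real k" if "3 \<le> k" for k
      using that exp_le by (intro ln_x_over_x_mono) auto
  qed (auto simp: sum_bound)
  have "ln (3::real) \<le> 2" using ln_le_minus_one[of "3::real"] by simp
  then have "C * (ln (real 3) / real 3) \<le> C * 2" using C_nonneg by (intro mult_left_mono) auto
  then have tail: "norm (\<Sum>k=3..x. t k) \<le> 2 * C" using tail by simp
  have head: "norm (t 1) + norm (t 2) \<le> 1"
  proof -
    have "norm (t 2) = ln 2 * norm (\<chi> 2) / 2" by (simp add: t)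
    moreover have "ln 2 * norm (\<chi> 2) \<le> ln 2 * 1" using norm_le_1 by (intro mult_left_mono) auto
    moreover have "norm (t 1) = 0" by (simp add: t)
    ultimately show ?thesis using ln_2_less_1 by linarith
  qed
  consider "x = 0" | "x = 1" | "x \<ge> 2" by linarith
  then have "norm (\<Sum>k=1..x. t k) \<le> 1 + 2 * C"
  proof cases
    case 3
    then have "{1..x} = {1,2} \<union> {3..x}" by auto
    then have "(\<Sum>k=1..x. t k) = t 1 + t 2 + (\<Sum>k=3..x. t k)"
      by (simp add: sum.union_disjoint)
    then show ?thesis
      using head tail norm_triangle_ineq[of "t 1 + t 2" "\<Sum>k=3..x. t k"] norm_triangle_ineq[of "t 1" "t 2"]
      by simp
  qed (use C_nonneg in \<open>auto simp: t\<close>)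
  then show ?thesis unfolding t_def .
qed

text \<open>
  Twisting \<open>ln m = (\<Sum>d | d dvd m. mangoldt d)\<close> by \<open>\<chi> m / m\<close> and summing expresses a bounded
  quantity as the sum of \<open>\<chi> d * mangoldt d / d\<close> times the partial sum of \<open>L(1,\<chi>)\<close> up to \<open>x div d\<close>. Replacing
  each partial sum by its limit costs at most \<open>C * chebyshev_psi x / x\<close>, which is bounded, and leaves
  \<open>L(1,\<chi>)\<close> times the sum in question.
\<close>

lemma twisted_mangoldt_sum_bounded:
  assumes "L_one \<noteq> 0"
  shows "\<exists>D. \<forall>x. norm (twisted_mangoldt_sum \<chi> x) \<le> D"
proof (intro exI allI)
  fix x
  show "norm (twisted_mangoldt_sum \<chi> x) \<le> (1 + 6 * C) / norm L_one"
  proof (cases "x = 0")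
    case True
    then show ?thesis using C_nonneg by (simp add: twisted_mangoldt_sum_def)
  next
    case False
    define g where "g d = \<chi> d * mangoldt d / of_nat d" for d
    have "(\<Sum>m=1..x. \<chi> m * ln (real m) / of_nat m)
        = (\<Sum>m=1..x. \<Sum>d | d dvd m. g d * (\<chi> (m div d) / of_nat (m div d)))"
    proof (rule sum.cong[OF refl])
      fix m assume "m \<in> {1..x}"
      then have m: "m > 0" by simp
      have "\<chi> m * ln (real m) / of_nat m = \<chi> m * (\<Sum>d | d dvd m. mangoldt d) / of_nat m"
        using mangoldt_sum[of m, where ?'a = complex] m by simp
      also have "\<dots> = (\<Sum>d | d dvd m. \<chi> m * mangoldt d / of_nat m)"
        by (simp only: sum_distrib_left sum_divide_distrib)
      also have "\<dots> = (\<Sum>d | d dvd m. g d * (\<chi> (m div d) / of_nat (m div d)))"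
      proof (rule sum.cong[OF refl])
        fix d assume "d \<in> {d. d dvd m}"
        then obtain e where e: "m = d * e" by auto
        then show "\<chi> m * mangoldt d / of_nat m = g d * (\<chi> (m div d) / of_nat (m div d))"
          using m by (simp add: g_def mult)
      qed
      finally show "\<chi> m * ln (real m) / of_nat m
          = (\<Sum>d | d dvd m. g d * (\<chi> (m div d) / of_nat (m div d)))" .
    qed
    also have "\<dots> = (\<Sum>d=1..x. \<Sum>e=1..x div d. g d * (\<chi> e / of_nat e))"
      by (rule sum_divisors_swap)
    also have "\<dots> = (\<Sum>d=1..x. g d * L_partial (x div d))"
      by (simp add: L_partial_def sum_distrib_left)
    finally have 1: "(\<Sum>m=1..x. \<chi> m * ln (real m) / of_nat m) = (\<Sum>d=1..x. g d * L_partial (x div d))" .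
    have "L_one * twisted_mangoldt_sum \<chi> x = (\<Sum>d=1..x. g d * L_one)"
      by (simp add: twisted_mangoldt_sum_def g_def sum_distrib_left mult.commute)
    also have "\<dots> = (\<Sum>d=1..x. g d * L_partial (x div d) + g d * (L_one - L_partial (x div d)))"
      by (simp add: algebra_simps)
    also have "\<dots> = (\<Sum>d=1..x. g d * L_partial (x div d))
        + (\<Sum>d=1..x. g d * (L_one - L_partial (x div d)))"
      by (rule sum.distrib)
    also have "norm \<dots> \<le> (1 + 2 * C) + 4 * C"
    proof (rule order_trans[OF norm_triangle_ineq] add_mono)+
      show "norm (\<Sum>d=1..x. g d * L_partial (x div d)) \<le> 1 + 2 * C"
        unfolding 1[symmetric] by (rule sum_ln_bounded)
      have "norm (\<Sum>d=1..x. g d * (L_one - L_partial (x div d))) \<le> (\<Sum>d=1..x. mangoldt d * (C / real x))"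
      proof (rule sum_norm_le)
        fix d assume "d \<in> {1..x}"
        then have d: "d > 0" by simp
        have "norm (g d) \<le> mangoldt d / real d"
          unfolding g_def using norm_le_1[of d] mangoldt_nonneg[of d] d
          by (simp add: norm_mult norm_divide mult_left_le_one_le divide_right_mono)
        then have "norm (g d * (L_one - L_partial (x div d))) \<le> mangoldt d / real d * (C * real d / real x)"
          unfolding norm_mult using L_tail_div[OF d, of x] False mangoldt_nonneg[of d]
          by (intro mult_mono) auto
        also have "\<dots> = mangoldt d * (C / real x)" using d by simp
        finally show "norm (g d * (L_one - L_partial (x div d))) \<le> mangoldt d * (C / real x)" .
      qed
      also have "\<dots> = chebyshev_psi x * (C / real x)"
        by (simp add: chebyshev_psi_def sum_distrib_right sum_divide_distrib)
      also have "\<dots> \<le> (4 * real x) * (C / real x)"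
        using C_nonneg chebyshev_psi_le by (intro mult_right_mono) auto
      also have "\<dots> = 4 * C" using False by simp
      finally show "norm (\<Sum>d=1..x. g d * (L_one - L_partial (x div d))) \<le> 4 * C" .
    qed
    finally show ?thesis using assms by (simp add: norm_mult field_simps)
  qed
qed

text \<open>
  By the two divisor sums of the Moebius function, the sum of \<open>moebius d * ln (x / d)\<close> over the divisors of
  \<open>m\<close> is \<open>mangoldt m\<close>, plus \<open>ln x\<close> if \<open>m = 1\<close>. Twisting by \<open>\<chi> m / m\<close> and summing therefore gives the left-hand side.
  On the other side of the convolution appear partial sums of \<open>L(1,\<chi>)\<close>, which are now themselves
  tails and hence of size \<open>d / x\<close>; the remaining sum of \<open>ln (x / d)\<close> is \<open>x * ln x - ln (fact x) \<le> x\<close>.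
\<close>

lemma twisted_mangoldt_sum_if_L_zero:
  assumes L: "L_one = 0" and x: "x > 0"
  shows "norm (twisted_mangoldt_sum \<chi> x + ln (real x)) \<le> C"
proof -
  define g where "g d = \<chi> d * of_real (moebius d * ln (real x / real d)) / of_nat d" for d
  have "(\<Sum>d=1..x. g d * L_partial (x div d)) = (\<Sum>d=1..x. \<Sum>e=1..x div d. g d * (\<chi> e / of_nat e))"
    by (simp add: L_partial_def sum_distrib_left)
  also have "\<dots> = (\<Sum>m=1..x. \<Sum>d | d dvd m. g d * (\<chi> (m div d) / of_nat (m div d)))"
    by (rule sum_divisors_swap[symmetric])
  also have "\<dots> = (\<Sum>m=1..x. (if m = 1 then of_real (ln (real x)) else 0) + \<chi> m * mangoldt m / of_nat m)"
  proof (rule sum.cong[OF refl])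
    fix m assume "m \<in> {1..x}"
    then have m: "m > 0" by simp
    have "(\<Sum>d | d dvd m. g d * (\<chi> (m div d) / of_nat (m div d)))
        = (\<Sum>d | d dvd m. \<chi> m / of_nat m * of_real (moebius d * ln (real x) - moebius d * ln (real d)))"
    proof (rule sum.cong[OF refl])
      fix d assume "d \<in> {d. d dvd m}"
      then obtain e where e: "m = d * e" by auto
      then have "d > 0" "e > 0" using m by (auto intro: gr0I)
      moreover from this have ln: "moebius d * ln (real x / real d) = moebius d * ln (real x) - moebius d * ln (real d)"
        using x by (simp add: ln_div right_diff_distrib)
      ultimately show "g d * (\<chi> (m div d) / of_nat (m div d))
          = \<chi> m / of_nat m * of_real (moebius d * ln (real x) - moebius d * ln (real d))"
        unfolding g_def ln by (simp add: e mult)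
    qed
    also have "\<dots> = \<chi> m / of_nat m * of_real (ln (real x) * (\<Sum>d | d dvd m. moebius d)
        - (\<Sum>d | d dvd m. moebius d * ln (real d)))"
      by (simp only: sum_distrib_left[symmetric] of_real_sum[symmetric] sum_subtractf
          sum_distrib_right[symmetric] mult.commute[of "ln (real x)"])
    also have "\<dots> = \<chi> m / of_nat m * of_real ((if m = 1 then ln (real x) else 0) + mangoldt m)"
      using sum_moebius_divisors[OF m] sum_moebius_ln_divisors[OF m] by simp
    also have "\<dots> = (if m = 1 then of_real (ln (real x)) else 0) + \<chi> m * mangoldt m / of_nat m"
      using one by (simp add: of_real_mangoldt)
    finally show "(\<Sum>d | d dvd m. g d * (\<chi> (m div d) / of_nat (m div d)))
        = (if m = 1 then of_real (ln (real x)) else 0) + \<chi> m * mangoldt m / of_nat m" .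
  qed
  also have "\<dots> = twisted_mangoldt_sum \<chi> x + ln (real x)"
    using x by (simp add: sum.distrib twisted_mangoldt_sum_def sum.delta Suc_le_eq)
  finally have "twisted_mangoldt_sum \<chi> x + ln (real x) = (\<Sum>d=1..x. g d * L_partial (x div d))" by simp
  also have "norm \<dots> \<le> (\<Sum>d=1..x. ln (real x / real d) * (C / real x))"
  proof (rule sum_norm_le)
    fix d assume "d \<in> {1..x}"
    then have d: "d > 0" "d \<le> x" by auto
    have ln0: "ln (real x / real d) \<ge> 0" using d by simp
    have "norm (g d) = norm (\<chi> d) * \<bar>moebius d\<bar> * ln (real x / real d) / real d"
      unfolding g_def using ln0 by (simp add: norm_mult norm_divide abs_mult)
    also have "\<dots> \<le> 1 * 1 * ln (real x / real d) / real d"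
      using ln0 norm_le_1[of d] abs_moebius_le[of d]
      by (intro divide_right_mono mult_right_mono mult_mono) auto
    finally have "norm (g d) \<le> ln (real x / real d) / real d" by simp
    moreover have "norm (L_partial (x div d)) \<le> C * real d / real x"
      using L_tail_div[OF d(1) x] L by simp
    ultimately have "norm (g d * L_partial (x div d)) \<le> ln (real x / real d) / real d * (C * real d / real x)"
      unfolding norm_mult using ln0 by (intro mult_mono) auto
    also have "\<dots> = ln (real x / real d) * (C / real x)" using d by simp
    finally show "norm (g d * L_partial (x div d)) \<le> ln (real x / real d) * (C / real x)" .
  qed
  also have "\<dots> = (\<Sum>d=1..x. ln (real x) - ln (real d)) * (C / real x)"
    unfolding sum_distrib_right using x by (intro sum.cong) (auto simp: ln_div)
  also have "(\<Sum>d=1..x. ln (real x) - ln (real d)) = real x * ln (real x) - ln (fact x)"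
    by (simp add: sum_subtractf ln_fact_eq_sum)
  also have "(real x * ln (real x) - ln (fact x)) * (C / real x) \<le> real x * (C / real x)"
    using ln_fact_ge[of x] C_nonneg by (intro mult_right_mono) auto
  also have "\<dots> = C" using x by simp
  finally show ?thesis .
qed

lemma L_one_ne_0_if_real:
  assumes vals: "\<And>a. \<chi> a \<in> {-1, 0, 1}"
  shows "L_one \<noteq> 0"
proof
  assume L: "L_one = 0"
  define r where "r a = Re (\<chi> a)" for a
  have \<chi>: "\<chi> a = of_real (r a)" for a using vals[of a] by (auto simp: r_def)
  show False
  proof (rule real_character_L_ne_0)
    show "r (a * b) = r a * r b" for a b
      using mult[of a b] unfolding \<chi> of_real_mult[symmetric] of_real_eq_iff .
    show "r a \<in> {-1, 0, 1}" for a using vals[of a] by (auto simp: r_def)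
    show "r 1 = 1" using one by (simp add: r_def)
    show "\<bar>\<Sum>k=1..m. r k\<bar> \<le> C" for m
      using sum_bound[of 1 m] unfolding \<chi> of_real_sum[symmetric] norm_of_real .
    show "\<bar>\<Sum>k=1..m. r k / real k\<bar> \<le> C / (real m + 1)" for m
    proof -
      have "L_partial m = of_real (\<Sum>k=1..m. r k / real k)"
        by (simp add: L_partial_def \<chi>)
      then have "norm (L_partial m) = \<bar>\<Sum>k=1..m. r k / real k\<bar>" by (simp only: norm_of_real)
      then show ?thesis using L_tail[of m] L by simp
    qed
  qed
qed

end

section \<open>Dirichlet characters\<close>

definition dirichlet_characters :: "nat \<Rightarrow> (nat \<Rightarrow> complex) set" where
  "dirichlet_characters n = {\<chi>. (\<forall>a b. \<chi> (a * b) = \<chi> a * \<chi> b) \<and>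
     (\<forall>a. \<chi> (a mod n) = \<chi> a) \<and> (\<forall>a. \<chi> a \<noteq> 0 \<longleftrightarrow> coprime a n)}"

definition principal_character :: "nat \<Rightarrow> nat \<Rightarrow> complex" where
  "principal_character n a = (if coprime a n then 1 else 0)"

lemma dirichlet_characterD:
  assumes "\<chi> \<in> dirichlet_characters n"
  shows "\<chi> (a * b) = \<chi> a * \<chi> b" "\<chi> (a mod n) = \<chi> a" "\<chi> a = 0 \<longleftrightarrow> \<not> coprime a n"
  using assms by (auto simp: dirichlet_characters_def)

lemma dirichlet_character_cong:
  "\<chi> \<in> dirichlet_characters n \<Longrightarrow> [a = b] (mod n) \<Longrightarrow> \<chi> a = \<chi> b"
  by (metis cong_def dirichlet_characterD(2))

lemma dirichlet_character_one: "\<chi> \<in> dirichlet_characters n \<Longrightarrow> \<chi> 1 = 1"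
  using dirichlet_characterD(1)[of \<chi> n 1 1] dirichlet_characterD(3)[of \<chi> n 1] by simp

lemma dirichlet_character_power: "\<chi> \<in> dirichlet_characters n \<Longrightarrow> \<chi> (a ^ k) = \<chi> a ^ k"
  using dirichlet_character_one[of \<chi> n] by (induction k) (auto simp: dirichlet_characterD(1))

lemma dirichlet_character_root_of_unity:
  "\<chi> \<in> dirichlet_characters n \<Longrightarrow> coprime a n \<Longrightarrow> \<chi> a ^ totient n = 1"
  using euler_theorem[of a n] dirichlet_character_cong dirichlet_character_one
  by (metis dirichlet_character_power)

lemma norm_dirichlet_character:
  assumes "\<chi> \<in> dirichlet_characters n" "n > 0"
  shows "norm (\<chi> a) = (if coprime a n then 1 else 0)"
proof (cases "coprime a n")
  case True
  then have "norm (\<chi> a) ^ totient n = 1 ^ totient n"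
    using dirichlet_character_root_of_unity[OF assms(1)] by (metis norm_one norm_power power_one)
  then have "norm (\<chi> a) = 1"
    by (rule power_eq_imp_eq_base) (use assms in auto)
  with True show ?thesis by simp
qed (use dirichlet_characterD(3)[OF assms(1)] in simp)

lemma principal_character_mem: "principal_character n \<in> dirichlet_characters n"
  unfolding dirichlet_characters_def principal_character_def
  by (cases "n = 0") auto

lemma dirichlet_characters_mult:
  "\<chi> \<in> dirichlet_characters n \<Longrightarrow> \<psi> \<in> dirichlet_characters n \<Longrightarrow>
     (\<lambda>a. \<chi> a * \<psi> a) \<in> dirichlet_characters n"
  by (auto simp: dirichlet_characters_def)

lemma dirichlet_characters_cnj:
  "\<chi> \<in> dirichlet_characters n \<Longrightarrow> (\<lambda>a. cnj (\<chi> a)) \<in> dirichlet_characters n"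
  by (auto simp: dirichlet_characters_def)

lemma finite_dirichlet_characters:
  assumes n: "n > 0"
  shows "finite (dirichlet_characters n)"
proof -
  let ?R = "\<lambda>\<chi>. restrict \<chi> {..<n}"
  let ?Z = "insert 0 {z::complex. z ^ totient n = 1}"
  have "?R ` dirichlet_characters n \<subseteq> {..<n} \<rightarrow>\<^sub>E ?Z"
  proof (intro image_subsetI PiE_I)
    fix \<chi> a assume \<chi>: "\<chi> \<in> dirichlet_characters n"
    show "?R \<chi> a \<in> ?Z" if "a \<in> {..<n}"
      using that dirichlet_character_root_of_unity[OF \<chi>, of a] dirichlet_characterD(3)[OF \<chi>, of a]
      by (cases "coprime a n") simp_all
    show "?R \<chi> a = undefined" if "a \<notin> {..<n}"
      using that by simp
  qed
  moreover have "finite ({..<n} \<rightarrow>\<^sub>E ?Z)"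
  proof (intro finite_PiE finite_lessThan)
    have "finite {z::complex. z ^ totient n = 1}"
      using n by (intro finite_roots_unity) (simp add: Suc_le_eq)
    then show "finite ?Z" by simp
  qed
  moreover have "inj_on ?R (dirichlet_characters n)"
  proof (rule inj_onI, rule ext)
    fix \<chi> \<psi> a
    assume *: "\<chi> \<in> dirichlet_characters n" "\<psi> \<in> dirichlet_characters n" "?R \<chi> = ?R \<psi>"
    have "?R \<chi> (a mod n) = ?R \<psi> (a mod n)" using * by simp
    then have "\<chi> (a mod n) = \<psi> (a mod n)" using n by simp
    then show "\<chi> a = \<psi> a" using * by (simp add: dirichlet_characterD(2))
  qed
  ultimately show ?thesis by (meson finite_imageD finite_subset)
qed

text \<open>
  Multiplication by a \<open>b\<close> with \<open>\<chi> b \<noteq> 1\<close> permutes the residues and multiplies the sum by \<open>\<chi> b\<close>.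
\<close>

lemma sum_dirichlet_character_period:
  assumes \<chi>: "\<chi> \<in> dirichlet_characters n" and n: "n > 0" and np: "\<chi> \<noteq> principal_character n"
  shows "(\<Sum>k<n. \<chi> k) = 0"
proof -
  obtain b where "\<chi> b \<noteq> principal_character n b" using np by blast
  then have b: "coprime b n" "\<chi> b \<noteq> 1"
    using dirichlet_characterD(3)[OF \<chi>, of b] by (auto simp: principal_character_def split: if_splits)
  have inj: "inj_on (\<lambda>k. k * b mod n) {..<n}"
  proof (rule inj_onI)
    fix k k' assume k: "k \<in> {..<n}" "k' \<in> {..<n}" "k * b mod n = k' * b mod n"
    then have "[k = k'] (mod n)" using b cong_mult_rcancel_nat[of b n k k'] by (simp add: cong_def)
    then show "k = k'" using k by (simp add: cong_def)
  qed
  have "(\<lambda>k. k * b mod n) ` {..<n} = {..<n}"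
    using inj n by (intro endo_inj_surj) auto
  with inj have bij: "bij_betw (\<lambda>k. k * b mod n) {..<n} {..<n}" by (simp add: bij_betw_def)
  have "(\<Sum>k<n. \<chi> k) = (\<Sum>k<n. \<chi> (k * b mod n))"
    by (rule sum.reindex_bij_betw[OF bij, symmetric])
  also have "\<dots> = (\<Sum>k<n. \<chi> k) * \<chi> b"
    unfolding dirichlet_characterD(2)[OF \<chi>] dirichlet_characterD(1)[OF \<chi>] by (simp add: sum_distrib_right)
  finally have "(\<Sum>k<n. \<chi> k) * (1 - \<chi> b) = 0" by (simp add: algebra_simps)
  then show ?thesis using b by simp
qed

text \<open>
  The sum over \<open>n\<close> consecutive arguments vanishes, so every interval can be shortened to
  fewer than \<open>n\<close> terms.
\<close>

lemma bounded_character_dirichlet: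
  assumes \<chi>: "\<chi> \<in> dirichlet_characters n" and n: "n > 0" and np: "\<chi> \<noteq> principal_character n"
  shows "bounded_character \<chi> (real n)"
proof
  have le1: "norm (\<chi> a) \<le> 1" for a using norm_dirichlet_character[OF \<chi> n] by simp
  then show "norm (\<chi> a) \<le> 1" for a .
  have period: "\<chi> (a + n) = \<chi> a" for a
    using dirichlet_character_cong[OF \<chi>, of "a + n" a] by (simp add: cong_def)
  have block: "(\<Sum>k=a..<a+n. \<chi> k) = 0" for a
  proof (induction a)
    case 0
    then show ?case using sum_dirichlet_character_period[OF assms] by (simp add: atLeast0LessThan)
  next
    case (Suc a)
    have "(\<Sum>k=a..<Suc (a + n). \<chi> k) = (\<Sum>k=a..<a+n. \<chi> k) + \<chi> (a + n)" by simp
    moreover have "(\<Sum>k=a..<Suc (a + n). \<chi> k) = \<chi> a + (\<Sum>k=Suc a..<Suc (a + n). \<chi> k)"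
      by (rule sum.atLeast_Suc_lessThan) simp
    ultimately show ?case using Suc period[of a] by simp
  qed
  have bound: "norm (\<Sum>k=a..<a+m. \<chi> k) \<le> real n" for a m
  proof (induction m arbitrary: a rule: less_induct)
    case (less m)
    show ?case
    proof (cases "m < n")
      case True
      have "norm (\<Sum>k=a..<a+m. \<chi> k) \<le> (\<Sum>k=a..<a+m. 1)" by (rule sum_norm_le) (rule le1)
      then show ?thesis using True by simp
    next
      case False
      then have "(\<Sum>k=a..<a+m. \<chi> k) = (\<Sum>k=a..<a+n. \<chi> k) + (\<Sum>k=a+n..<a+m. \<chi> k)"
        by (intro sum.atLeastLessThan_concat[symmetric]) auto
      then have "(\<Sum>k=a..<a+m. \<chi> k) = (\<Sum>k=a+n..<(a+n)+(m-n). \<chi> k)" using block False by simp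
      then show ?thesis using less.IH[of "m - n" "a + n"] False n by simp
    qed
  qed
  show "norm (\<Sum>k=a..b. \<chi> k) \<le> real n" for a b
  proof (cases "a \<le> b")
    case True
    then have "{a..b} = {a..<a+(Suc b - a)}" by auto
    then show ?thesis using bound by simp
  qed simp
qed (use dirichlet_characterD(1)[OF \<chi>] dirichlet_character_one[OF \<chi>] in auto)

text \<open>
  A character of the group \<open>U n\<close> that is faithful on the powers of \<open>b\<close>, extended by zero to the numbers
  that are not coprime to \<open>n\<close>.
\<close>

lemma ex_separating_dirichlet_character:
  assumes n: "n > 0" and b: "coprime b n" "\<not> [b = 1] (mod n)"
  obtains \<psi> where "\<psi> \<in> dirichlet_characters n" "\<psi> b \<noteq> 1"
proof -
  have n1: "n > 1" using n b by (cases "n = 1") (auto simp: cong_def)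
  interpret U: comm_group "U n" using comm_group_U[OF n] .
  have car: "carrier (U n) = totatives n" by (simp add: U_def)
  have mem: "a mod n \<in> carrier (U n) \<longleftrightarrow> coprime a n" for a
  proof
    assume "coprime a n"
    then have "coprime (a mod n) n" using n1 by (simp add: coprime_mod_left_iff)
    moreover from this have "a mod n > 0" using n1 by (intro gr0I) auto
    ultimately show "a mod n \<in> carrier (U n)" using n1 by (simp add: car in_totatives_iff less_imp_le)
  next
    assume "a mod n \<in> carrier (U n)"
    then show "coprime a n" using n1 by (simp add: car in_totatives_iff coprime_mod_left_iff)
  qed
  have fin: "finite (carrier (U n))" by (simp add: car)
  have bU: "b mod n \<in> carrier (U n)" using b mem by simp
  obtain \<phi> where \<phi>: "U.character_on (carrier (U n)) \<phi>"
      "\<phi> (b mod n) = cis (2 * pi / real (U.ord (b mod n)))"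
    using U.ex_character_faithful_on_powers[OF fin bU] .
  define \<psi> where "\<psi> a = (if coprime a n then \<phi> (a mod n) else 0)" for a
  have "\<psi> \<in> dirichlet_characters n"
    unfolding dirichlet_characters_def
  proof (intro CollectI conjI allI)
    fix a c
    show "\<psi> (a * c) = \<psi> a * \<psi> c"
    proof (cases "coprime a n \<and> coprime c n")
      case True
      then have "\<phi> ((a mod n) \<otimes>\<^bsub>U n\<^esub> (c mod n)) = \<phi> (a mod n) * \<phi> (c mod n)"
        using \<phi>(1) mem by (simp add: U.character_on_def)
      moreover have "(a mod n) \<otimes>\<^bsub>U n\<^esub> (c mod n) = a * c mod n"
        using n1 by (simp add: U_def mod_mult_eq)
      ultimately show ?thesis using True by (simp add: \<psi>_def)
    qed (auto simp: \<psi>_def)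
    show "\<psi> (a mod n) = \<psi> a" using n by (simp add: \<psi>_def coprime_mod_left_iff)
    show "\<psi> a \<noteq> 0 \<longleftrightarrow> coprime a n"
      using \<phi>(1) mem[of a] by (auto simp: \<psi>_def U.character_on_def)
  qed
  moreover have "\<psi> b \<noteq> 1"
  proof
    assume "\<psi> b = 1"
    then have "cis (2 * pi / real (U.ord (b mod n))) ^ 1 = 1" using b \<phi>(2) by (simp add: \<psi>_def)
    then have "U.ord (b mod n) dvd 1"
      using cis_pow_eq_1_imp_dvd U.ord_ge_1[OF fin bU] by (metis Suc_le_lessD One_nat_def)
    then have "b mod n = \<one>\<^bsub>U n\<^esub>" using U.ord_eq_1[OF bU] by simp
    then have "b mod n = 1" by (simp add: U_def)
    then show False using b n1 by (simp add: cong_def)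
  qed
  ultimately show ?thesis using that by blast
qed

text \<open>
  Orthogonality: multiplication by a character \<open>\<psi>\<close> with \<open>\<psi> b \<noteq> 1\<close> permutes the characters and
  multiplies the sum by \<open>\<psi> b\<close>.
\<close>

lemma sum_over_dirichlet_characters:
  assumes n: "n > 0" and b: "coprime b n"
  shows "(\<Sum>\<chi>\<in>dirichlet_characters n. \<chi> b) = (if [b = 1] (mod n) then of_nat (card (dirichlet_characters n)) else 0)"
proof (cases "[b = 1] (mod n)")
  case True
  have "(\<Sum>\<chi>\<in>dirichlet_characters n. \<chi> b) = (\<Sum>\<chi>\<in>dirichlet_characters n. 1)"
    using dirichlet_character_cong[OF _ True] dirichlet_character_one by (intro sum.cong refl) metis
  then show ?thesis using True by simp
next
  case False
  let ?X = "dirichlet_characters n"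
  obtain \<psi> where \<psi>: "\<psi> \<in> ?X" "\<psi> b \<noteq> 1"
    using ex_separating_dirichlet_character[OF n b False] .
  let ?f = "\<lambda>\<chi> a. \<psi> a * \<chi> a"
  have inj: "inj_on ?f ?X"
  proof (rule inj_onI, rule ext)
    fix \<chi> \<chi>' a assume *: "\<chi> \<in> ?X" "\<chi>' \<in> ?X" "?f \<chi> = ?f \<chi>'"
    have "\<psi> a * \<chi> a = \<psi> a * \<chi>' a" using * by meson
    then show "\<chi> a = \<chi>' a"
      using dirichlet_characterD(3)[of _ n a] \<psi>(1) *(1,2) by (metis mult_cancel_left)
  qed
  have "?f ` ?X = ?X"
    using inj dirichlet_characters_mult[OF \<psi>(1)]
    by (intro endo_inj_surj finite_dirichlet_characters[OF n]) auto
  then have "(\<Sum>\<chi>\<in>?X. \<chi> b) = (\<Sum>\<chi>\<in>?f ` ?X. \<chi> b)" by simp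
  also have "\<dots> = (\<Sum>\<chi>\<in>?X. \<psi> b * \<chi> b)" using inj by (simp add: sum.reindex)
  also have "\<dots> = \<psi> b * (\<Sum>\<chi>\<in>?X. \<chi> b)" by (simp only: sum_distrib_left)
  finally have "(1 - \<psi> b) * (\<Sum>\<chi>\<in>?X. \<chi> b) = 0" by (simp add: left_diff_distrib)
  then show ?thesis using \<psi> False by simp
qed

section \<open>Primes in arithmetic progressions\<close>

definition progression_mangoldt_sum :: "nat \<Rightarrow> nat \<Rightarrow> nat \<Rightarrow> real" where
  "progression_mangoldt_sum n a x = (\<Sum>m | m \<in> {1..x} \<and> [m = a] (mod n). mangoldt m / real m)"

text \<open>
  Evaluating at an inverse \<open>b\<close> of \<open>a\<close> modulo \<open>n\<close> plays the role of conjugating \<open>\<chi> a\<close>.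
\<close>

lemma progression_mangoldt_sum_eq:
  assumes n: "n > 0" and ab: "[b * a = 1] (mod n)"
  shows "(\<Sum>\<chi>\<in>dirichlet_characters n. \<chi> b * twisted_mangoldt_sum \<chi> x)
    = of_real (real (card (dirichlet_characters n)) * progression_mangoldt_sum n a x)"
proof -
  let ?X = "dirichlet_characters n"
  have cop: "coprime b n" "coprime a n"
    using ab by (metis coprime_mult_left_iff cong_imp_coprime coprime_1_left cong_sym)+
  have "(\<Sum>\<chi>\<in>?X. \<chi> b * twisted_mangoldt_sum \<chi> x)
      = (\<Sum>\<chi>\<in>?X. \<Sum>m=1..x. \<chi> (b * m) * (mangoldt m / of_nat m))"
    unfolding twisted_mangoldt_sum_def sum_distrib_left
    by (intro sum.cong refl) (simp add: dirichlet_characterD(1))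
  also have "\<dots> = (\<Sum>m=1..x. (\<Sum>\<chi>\<in>?X. \<chi> (b * m)) * (mangoldt m / of_nat m))"
    by (subst sum.swap) (simp only: sum_distrib_right)
  also have "\<dots> = (\<Sum>m=1..x. if [m = a] (mod n) then of_nat (card ?X) * (mangoldt m / of_nat m) else 0)"
  proof (rule sum.cong[OF refl])
    fix m
    have "(\<Sum>\<chi>\<in>?X. \<chi> (b * m)) = (if [m = a] (mod n) then of_nat (card ?X) else 0)"
    proof (cases "coprime m n")
      case True
      then have "coprime (b * m) n" using cop by simp
      moreover have "[b * m = 1] (mod n) \<longleftrightarrow> [m = a] (mod n)"
      proof -
        have "[b * m = 1] (mod n) \<longleftrightarrow> [b * m = b * a] (mod n)"
          using ab cong_sym cong_trans by blast
        then show ?thesis using cong_mult_lcancel_nat[OF cop(1)] by simp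
      qed
      ultimately show ?thesis using sum_over_dirichlet_characters[OF n] by simp
    next
      case False
      then have "\<not> [m = a] (mod n)" using cop(2) cong_imp_coprime cong_sym by blast
      moreover have "\<chi> (b * m) = 0" if "\<chi> \<in> ?X" for \<chi>
        using dirichlet_characterD(3)[OF that] False by simp
      then have "(\<Sum>\<chi>\<in>?X. \<chi> (b * m)) = 0" by (intro sum.neutral) blast
      ultimately show ?thesis by simp
    qed
    then show "(\<Sum>\<chi>\<in>?X. \<chi> (b * m)) * (mangoldt m / of_nat m)
        = (if [m = a] (mod n) then of_nat (card ?X) * (mangoldt m / of_nat m) else 0)" by simp
  qed
  also have "\<dots> = (\<Sum>m | m \<in> {1..x} \<and> [m = a] (mod n). of_nat (card ?X) * (mangoldt m / of_nat m))"
    by (simp add: sum.inter_filter[symmetric])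
  also have "\<dots> = of_real (real (card ?X) * progression_mangoldt_sum n a x)"
    by (simp add: progression_mangoldt_sum_def sum_distrib_left)
  finally show ?thesis .
qed

lemma twisted_mangoldt_sum_principal:
  "twisted_mangoldt_sum (principal_character n) x
     = of_real (\<Sum>m | m \<in> {1..x} \<and> coprime m n. mangoldt m / real m)"
proof -
  have "twisted_mangoldt_sum (principal_character n) x
      = (\<Sum>m=1..x. if coprime m n then mangoldt m / of_nat m else 0)"
    unfolding twisted_mangoldt_sum_def principal_character_def by (intro sum.cong) auto
  also have "\<dots> = (\<Sum>m | m \<in> {1..x} \<and> coprime m n. mangoldt m / of_nat m)"
    by (simp add: sum.inter_filter[symmetric])
  finally show ?thesis by simp
qed

lemma twisted_mangoldt_sum_principal_le:
  assumes "x > 0"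
  shows "Re (twisted_mangoldt_sum (principal_character n) x) \<le> ln x + 4"
proof -
  have "(\<Sum>m | m \<in> {1..x} \<and> coprime m n. mangoldt m / real m) \<le> (\<Sum>m=1..x. mangoldt m / real m)"
    by (rule sum_mono2) (auto simp: mangoldt_nonneg)
  then show ?thesis
    using sum_mangoldt_over_le[OF assms] unfolding twisted_mangoldt_sum_principal by simp
qed

text \<open>
  An \<open>m\<close> that is not coprime to \<open>n\<close> is either not prime or a prime divisor of \<open>n\<close>, hence at most \<open>n\<close>. Both kinds
  contribute a bounded amount to the Mertens sum.
\<close>

lemma twisted_mangoldt_sum_principal_ge:
  assumes n: "n > 0" and x: "x > 0"
  shows "ln x - 9 - (\<Sum>m=1..n. mangoldt m / real m) \<le> Re (twisted_mangoldt_sum (principal_character n) x)"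
proof -
  let ?f = "\<lambda>m. mangoldt m / real m"
  have f0: "0 \<le> ?f m" for m by (simp add: mangoldt_nonneg)
  have "sum ?f {1..x} \<le> sum ?f ({m. m \<in> {1..x} \<and> coprime m n} \<union> ({m. m \<in> {1..x} \<and> \<not> prime m} \<union> {1..n}))"
  proof (rule sum_mono2)
    show "{1..x} \<subseteq> {m. m \<in> {1..x} \<and> coprime m n} \<union> ({m. m \<in> {1..x} \<and> \<not> prime m} \<union> {1..n})"
    proof
      fix m assume m: "m \<in> {1..x}"
      have "m \<le> n" if "prime m" "\<not> coprime m n"
        using that prime_imp_coprime n dvd_imp_le by blast
      then show "m \<in> {m. m \<in> {1..x} \<and> coprime m n} \<union> ({m. m \<in> {1..x} \<and> \<not> prime m} \<union> {1..n})"
        using m by auto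
    qed
  qed (use f0 in auto)
  also have "\<dots> \<le> sum ?f {m. m \<in> {1..x} \<and> coprime m n} + (sum ?f {m. m \<in> {1..x} \<and> \<not> prime m} + sum ?f {1..n})"
  proof -
    have un: "sum ?f (A \<union> B) \<le> sum ?f A + sum ?f B" if "finite A" "finite B" for A B
      using that sum.union_inter[of A B ?f] sum_nonneg[of "A \<inter> B" ?f] f0 by simp
    show ?thesis
      by (rule order_trans[OF un add_left_mono[OF un]]) auto
  qed
  also have "sum ?f {m. m \<in> {1..x} \<and> \<not> prime m} \<le> 8" by (rule sum_mangoldt_nonprime_le)
  finally show ?thesis
    using sum_mangoldt_over_ge[OF x] unfolding twisted_mangoldt_sum_principal by simp
qed

lemma not_ln_bounded: "\<not> (\<forall>x::nat. x > 0 \<longrightarrow> ln (real x) \<le> K)"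
proof
  assume *: "\<forall>x::nat. x > 0 \<longrightarrow> ln (real x) \<le> K"
  obtain x :: nat where x: "real x > exp K" using reals_Archimedean2 by blast
  then have "x > 0" by (metis exp_gt_zero less_trans of_nat_0_less_iff)
  then have "ln (real x) \<le> K" using * by blast
  then have "real x \<le> exp K" using \<open>x > 0\<close> exp_le_cancel_iff[of "ln (real x)" K] by simp
  then show False using x by simp
qed

text \<open>
  If \<open>L(1,\<chi>) = 0\<close> and \<open>\<chi>\<close> is not real, then \<open>\<chi>\<close> and its conjugate are two different characters whose
  twisted sums are \<open>- ln x + O(1)\<close>. The principal character contributes only one \<open>ln x\<close> and all other
  characters are bounded above, so the sum over the progression of \<open>1\<close> would become negative.
\<close>

lemma L_one_ne_0_dirichlet:
  assumes \<chi>: "\<chi> \<in> dirichlet_characters n" and n: "n > 0" and np: "\<chi> \<noteq> principal_character n"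
  shows "bounded_character.L_one \<chi> \<noteq> 0"
proof
  let ?X = "dirichlet_characters n"
  let ?A = twisted_mangoldt_sum
  let ?\<chi>' = "\<lambda>a. cnj (\<chi> a)"
  interpret bounded_character \<chi> "real n" by (rule bounded_character_dirichlet[OF assms])
  assume L: "L_one = 0"
  show False
  proof (cases "?\<chi>' = \<chi>")
    case True
    have "\<chi> a \<in> {-1, 0, 1}" for a
    proof -
      have "\<chi> a \<in> \<real>" using True by (metis Reals_cnj_iff)
      then obtain t where t: "\<chi> a = of_real t" by (auto elim: Reals_cases)
      have "\<bar>t\<bar> \<in> {0, 1}"
        using norm_dirichlet_character[OF \<chi> n, of a] unfolding t norm_of_real by (auto split: if_splits)
      then show ?thesis by (auto simp: t abs_if split: if_splits)
    qed
    then show False using L_one_ne_0_if_real L by blast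
  next
    case False
    have \<chi>': "?\<chi>' \<in> ?X" using dirichlet_characters_cnj[OF \<chi>] .
    have np': "?\<chi>' \<noteq> principal_character n"
    proof
      assume *: "?\<chi>' = principal_character n"
      have "\<chi> a = principal_character n a" for a
        using fun_cong[OF *, of a] by (auto simp: principal_character_def complex_cnj_cancel_iff split: if_splits)
      then show False using np by blast
    qed
    have bound: "\<exists>D. \<forall>x>0. Re (?A \<psi> x) \<le> D" if \<psi>: "\<psi> \<in> ?X" "\<psi> \<noteq> principal_character n" for \<psi>
    proof -
      interpret \<psi>: bounded_character \<psi> "real n" by (rule bounded_character_dirichlet[OF \<psi>(1) n \<psi>(2)])
      show ?thesis
      proof (cases "\<psi>.L_one = 0")
        case False
        then obtain D where "norm (?A \<psi> x) \<le> D" for x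
          using \<psi>.twisted_mangoldt_sum_bounded by blast
        then show ?thesis using complex_Re_le_cmod order_trans by blast
      next
        case True
        have "Re (?A \<psi> x) \<le> real n" if "x > 0" for x
        proof -
          have "Re (?A \<psi> x + ln (real x)) \<le> real n"
            using \<psi>.twisted_mangoldt_sum_if_L_zero[OF True that] complex_Re_le_cmod order_trans
            by blast
          moreover have "ln (real x) \<ge> 0" using that by simp
          ultimately show ?thesis by simp
        qed
        then show ?thesis by blast
      qed
    qed
    then obtain D where D: "Re (?A \<psi> x) \<le> D \<psi>"
      if "\<psi> \<in> ?X" "\<psi> \<noteq> principal_character n" "x > 0" for \<psi> x by metis
    define Y where "Y = ?X - {principal_character n, \<chi>, ?\<chi>'}"
    have finX: "finite ?X" using finite_dirichlet_characters[OF n] .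
    have X: "?X = insert (principal_character n) (insert \<chi> (insert ?\<chi>' Y))"
      using \<chi> \<chi>' principal_character_mem by (auto simp: Y_def)
    have finY: "finite Y" using finX by (simp add: Y_def)
    have "ln (real x) \<le> 4 + 2 * real n + sum D Y" if x: "x > 0" for x :: nat
    proof -
      have "0 \<le> real (card ?X) * progression_mangoldt_sum n 1 x"
        unfolding progression_mangoldt_sum_def by (intro mult_nonneg_nonneg sum_nonneg) (auto simp: mangoldt_nonneg)
      also have "\<dots> = Re (\<Sum>\<psi>\<in>?X. \<psi> 1 * ?A \<psi> x)"
        using progression_mangoldt_sum_eq[OF n, of 1 1 x] by simp
      also have "(\<Sum>\<psi>\<in>?X. \<psi> 1 * ?A \<psi> x) = (\<Sum>\<psi>\<in>?X. ?A \<psi> x)"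
        using dirichlet_character_one by (intro sum.cong) auto
      also have "\<dots> = ?A (principal_character n) x + (?A \<chi> x + (?A ?\<chi>' x + (\<Sum>\<psi>\<in>Y. ?A \<psi> x)))"
        unfolding X using finY np np' False
        by (subst sum.insert, simp, force simp: Y_def)+ simp
      finally have 0: "0 \<le> Re (?A (principal_character n) x) + Re (?A \<chi> x) + Re (?A ?\<chi>' x) + (\<Sum>\<psi>\<in>Y. Re (?A \<psi> x))"
        by simp
      have "cnj (mangoldt m) = mangoldt m" for m by (simp add: mangoldt_def)
      then have "?A ?\<chi>' x = cnj (?A \<chi> x)" by (simp add: twisted_mangoldt_sum_def)
      then have 1: "Re (?A ?\<chi>' x) = Re (?A \<chi> x)" by simp
      have "Re (?A \<chi> x + ln (real x)) \<le> real n"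
        using twisted_mangoldt_sum_if_L_zero[OF L x] complex_Re_le_cmod order_trans
        by blast
      then have 2: "Re (?A \<chi> x) \<le> real n - ln (real x)" by simp
      have 3: "(\<Sum>\<psi>\<in>Y. Re (?A \<psi> x)) \<le> sum D Y" using D x by (intro sum_mono) (auto simp: Y_def)
      have 4: "Re (?A (principal_character n) x) \<le> ln (real x) + 4"
        by (rule twisted_mangoldt_sum_principal_le[OF x])
      show ?thesis using 0 1 2 3 4 by linarith
    qed
    then show False using not_ln_bounded by blast
  qed
qed

text \<open>
  The sum of \<open>mangoldt m / m\<close> over the progression grows like \<open>ln x\<close>, because only the principal
  character contributes an unbounded term. With finitely many primes in the progression it would be bounded, as the
  proper prime powers contribute a bounded amount.
\<close>

theorem dirichlet_primes_in_progression:
  fixes n a :: nat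
  assumes n: "n > 0" and a: "coprime a n"
  shows "infinite {p. prime p \<and> [p = a] (mod n)}"
proof
  let ?X = "dirichlet_characters n"
  let ?A = twisted_mangoldt_sum
  let ?P = "{p. prime p \<and> [p = a] (mod n)}"
  assume fin: "finite ?P"
  define F where "F = (\<Sum>p\<in>?P. mangoldt p / real p)"
  have upper: "progression_mangoldt_sum n a x \<le> F + 8" for x
  proof -
    let ?f = "\<lambda>m. mangoldt m / real m"
    have f0: "0 \<le> ?f m" for m by (simp add: mangoldt_nonneg)
    let ?B = "{m. m \<in> {1..x} \<and> \<not> prime m}"
    have "progression_mangoldt_sum n a x \<le> sum ?f (?P \<union> ?B)"
      unfolding progression_mangoldt_sum_def using fin f0 by (intro sum_mono2) auto
    also have "\<dots> = F + sum ?f ?B"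
      unfolding F_def using fin by (intro sum.union_disjoint) auto
    finally show ?thesis using sum_mangoldt_nonprime_le[of x] by linarith
  qed
  obtain b where "[a * b = 1] (mod n)" using cong_solve_coprime_nat[OF a] by auto
  then have b: "[b * a = 1] (mod n)" by (simp add: mult.commute)
  then have bn: "coprime b n" by (metis coprime_mult_left_iff cong_imp_coprime coprime_1_left cong_sym)
  have "\<exists>D. \<forall>x. norm (?A \<psi> x) \<le> D" if \<psi>: "\<psi> \<in> ?X" "\<psi> \<noteq> principal_character n" for \<psi>
  proof -
    interpret bounded_character \<psi> "real n" by (rule bounded_character_dirichlet[OF \<psi>(1) n \<psi>(2)])
    show ?thesis
      using twisted_mangoldt_sum_bounded[OF L_one_ne_0_dirichlet[OF \<psi>(1) n \<psi>(2)]] .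
  qed
  then obtain D where D: "norm (?A \<psi> x) \<le> D \<psi>"
    if "\<psi> \<in> ?X" "\<psi> \<noteq> principal_character n" for \<psi> x by metis
  define Y where "Y = ?X - {principal_character n}"
  have finY: "finite Y" using finite_dirichlet_characters[OF n] by (simp add: Y_def)
  have X: "?X = insert (principal_character n) Y" using principal_character_mem by (auto simp: Y_def)
  let ?E = "\<Sum>m=1..n. mangoldt m / real m"
  have "ln (real x) \<le> 9 + ?E + sum D Y + real (card ?X) * (F + 8)" if x: "x > 0" for x :: nat
  proof -
    have "(\<Sum>\<psi>\<in>?X. \<psi> b * ?A \<psi> x) = ?A (principal_character n) x + (\<Sum>\<psi>\<in>Y. \<psi> b * ?A \<psi> x)"
      unfolding X using finY bn by (subst sum.insert) (auto simp: Y_def principal_character_def)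
    then have "Re (?A (principal_character n) x) + Re (\<Sum>\<psi>\<in>Y. \<psi> b * ?A \<psi> x)
        = real (card ?X) * progression_mangoldt_sum n a x"
      using progression_mangoldt_sum_eq[OF n b, of x] by (metis Re_complex_of_real plus_complex.sel(1))
    also have "\<dots> \<le> real (card ?X) * (F + 8)" using upper by (intro mult_left_mono) auto
    finally have 1: "Re (?A (principal_character n) x) + Re (\<Sum>\<psi>\<in>Y. \<psi> b * ?A \<psi> x) \<le> real (card ?X) * (F + 8)" .
    have "norm (\<Sum>\<psi>\<in>Y. \<psi> b * ?A \<psi> x) \<le> sum D Y"
    proof (rule sum_norm_le)
      fix \<psi> assume "\<psi> \<in> Y"
      then have \<psi>: "\<psi> \<in> ?X" "\<psi> \<noteq> principal_character n" by (auto simp: Y_def)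
      show "norm (\<psi> b * ?A \<psi> x) \<le> D \<psi>"
        using D[OF \<psi>] norm_dirichlet_character[OF \<psi>(1) n, of b] bn by (simp add: norm_mult)
    qed
    then have "- sum D Y \<le> Re (\<Sum>\<psi>\<in>Y. \<psi> b * ?A \<psi> x)"
      using abs_Re_le_cmod[of "\<Sum>\<psi>\<in>Y. \<psi> b * ?A \<psi> x"] by linarith
    then show ?thesis using 1 twisted_mangoldt_sum_principal_ge[OF n x] by linarith
  qed
  then show False using not_ln_bounded by blast
qed

section \<open>Groups of power residues\<close>

lemma U_nat_pow:
  assumes "n > 1"
  shows "a [^]\<^bsub>U n\<^esub> (k::nat) = (if k = 0 then 1 else a ^ k mod n)"
  using assms by (induction k) (auto simp: U_def nat_pow_def mod_mult_left_eq mod_mult_right_eq mult.commute)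

lemma carrier_U_pow:
  assumes n: "n > 1"
  shows "carrier (U_pow n d) = (\<lambda>a. a ^ d mod n) ` totatives n"
proof -
  have "a [^]\<^bsub>U n\<^esub> d = a ^ d mod n" for a
    using n by (simp add: U_nat_pow[OF n])
  then show ?thesis by (auto simp: U_pow_def U_def)
qed

lemma mult_U_pow: "n > 1 \<Longrightarrow> a \<otimes>\<^bsub>U_pow n d\<^esub> b = a * b mod n"
  by (simp add: U_pow_def U_def)

lemma comm_group_U_pow:
  assumes "n > 0"
  shows "comm_group (U_pow n d)"
proof -
  interpret comm_group "U n" by (rule comm_group_U[OF assms])
  have eq: "U_pow n d = (U n)\<lparr>carrier := carrier (U_pow n d)\<rparr>" by (simp add: U_pow_def)
  have sub: "subgroup (carrier (U_pow n d)) (U n)" by (rule subgroup_U_pow[OF assms])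
  interpret P: group "U_pow n d" by (subst eq) (rule subgroup_imp_group[OF sub])
  show ?thesis
  proof (rule P.group_comm_groupI)
    fix x y assume "x \<in> carrier (U_pow n d)" "y \<in> carrier (U_pow n d)"
    then have "x \<otimes>\<^bsub>U n\<^esub> y = y \<otimes>\<^bsub>U n\<^esub> x"
      using subgroup.subset[OF sub] by (intro m_comm) auto
    then show "x \<otimes>\<^bsub>U_pow n d\<^esub> y = y \<otimes>\<^bsub>U_pow n d\<^esub> x" by (simp add: U_pow_def)
  qed
qed

lemma U_pow_coprime_mult_iso:
  assumes m: "m > 1" and n: "n > 1" and cop: "coprime m n"
  shows "U_pow (m * n) d \<cong> U_pow m d \<times>\<times> U_pow n d"
proof -
  let ?f = "\<lambda>x. (x mod m, x mod n)"
  have mn: "m * n > 1" by (rule less_1_mult[OF m n])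
  have bij: "bij_betw ?f (totatives (m * n)) (totatives m \<times> totatives n)"
    by (rule bij_betw_totatives[OF m n cop])
  have fpow: "?f (a ^ d mod (m * n)) = ((a mod m) ^ d mod m, (a mod n) ^ d mod n)" for a
    by (simp add: mod_mod_cancel power_mod)
  have "?f \<in> iso (U_pow (m * n) d) (U_pow m d \<times>\<times> U_pow n d)"
  proof (rule isoI)
    have img: "?f ` carrier (U_pow (m * n) d) = carrier (U_pow m d \<times>\<times> U_pow n d)"
    proof -
      have "?f ` carrier (U_pow (m * n) d)
          = (\<lambda>(b, c). (b ^ d mod m, c ^ d mod n)) ` ?f ` totatives (m * n)"
        unfolding carrier_U_pow[OF mn] image_image using fpow by simp
      also have "?f ` totatives (m * n) = totatives m \<times> totatives n"
        using bij by (simp add: bij_betw_def)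
      finally show ?thesis by (auto simp: carrier_U_pow[OF m] carrier_U_pow[OF n] image_iff)
    qed
    show "?f \<in> hom (U_pow (m * n) d) (U_pow m d \<times>\<times> U_pow n d)"
    proof (rule homI)
      show "?f x \<in> carrier (U_pow m d \<times>\<times> U_pow n d)" if "x \<in> carrier (U_pow (m * n) d)" for x
        using img that by blast
      show "?f (x \<otimes>\<^bsub>U_pow (m * n) d\<^esub> y) = ?f x \<otimes>\<^bsub>U_pow m d \<times>\<times> U_pow n d\<^esub> ?f y" for x y
        using m n mn by (simp add: mult_U_pow mod_mod_cancel mod_mult_eq)
    qed
    have "inj_on ?f (carrier (U_pow (m * n) d))"
    proof (rule inj_on_subset)
      show "inj_on ?f (totatives (m * n))" using bij by (simp add: bij_betw_def)
      show "carrier (U_pow (m * n) d) \<subseteq> totatives (m * n)"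
        using subgroup.subset[OF subgroup_U_pow, of "m * n" d] m n by (simp add: U_def)
    qed
    with img show "bij_betw ?f (carrier (U_pow (m * n) d)) (carrier (U_pow m d \<times>\<times> U_pow n d))"
      by (simp add: bij_betw_def)
  qed
  then show ?thesis by (rule is_isoI)
qed

text \<open>
  Powers of a primitive root \<open>g\<close> of \<open>p\<close> are determined by their exponents modulo \<open>k * m\<close>. As \<open>s\<close> is invertible
  modulo \<open>m\<close>, the exponents \<open>i * k * s\<close> and \<open>j * k * s\<close> agree modulo \<open>k * m\<close> exactly if \<open>i\<close> and \<open>j\<close> agree
  modulo \<open>m\<close>.
\<close>

lemma U_pow_prime_iso_cyclic:
  assumes p: "prime p" and pm: "p - 1 = k * m" and d: "d = k * s" and cop: "coprime s m"
  shows "integer_mod_group m \<cong> U_pow p d"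
proof -
  have p1: "p > 1" using prime_gt_1_nat[OF p] .
  have km: "k > 0" "m > 0" using pm p1 by (auto intro: gr0I)
  obtain g where g: "residue_primroot p g"
    using prime_primitive_root_exists[OF p1 p] by blast
  have og: "ord p g = k * m" and cg: "coprime p g"
    using g pm by (auto simp: residue_primroot_def totient_prime[OF p])
  have tot: "totatives p = (\<lambda>i. g ^ i mod p) ` {..<totient p}"
    using residue_primroot_is_generator[OF p1 g] by (simp add: bij_betw_def)
  have eq_iff: "(g ^ i) ^ d mod p = (g ^ j) ^ d mod p \<longleftrightarrow> [i = j] (mod m)" for i j
  proof -
    have "(g ^ i) ^ d mod p = (g ^ j) ^ d mod p \<longleftrightarrow> [i * d = j * d] (mod (k * m))"
      using order_divides_expdiff[OF cg, of "i * d" "j * d"] by (simp add: cong_def power_mult og)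
    also have "\<dots> \<longleftrightarrow> [k * (s * i) = k * (s * j)] (mod (k * m))" by (simp add: d mult_ac)
    also have "\<dots> \<longleftrightarrow> [s * i = s * j] (mod m)"
      using km by (simp add: cong_def flip: mult_mod_right)
    also have "\<dots> \<longleftrightarrow> [i = j] (mod m)" by (rule cong_mult_lcancel_nat[OF cop])
    finally show ?thesis .
  qed
  let ?f = "\<lambda>i::int. (g ^ nat i) ^ d mod p"
  have car: "carrier (integer_mod_group m) = {0..<int m}" using km by (simp add: carrier_integer_mod_group)
  have img: "?f ` {0..<int m} = carrier (U_pow p d)"
  proof (intro equalityI subsetI)
    fix y assume "y \<in> ?f ` {0..<int m}"
    then obtain i where i: "y = (g ^ i) ^ d mod p" by blast
    have "g ^ i mod p \<in> totatives p"
      using power_in_totatives[of p g i] p1 cg by simp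
    then have "(g ^ i mod p) ^ d mod p \<in> carrier (U_pow p d)"
      unfolding carrier_U_pow[OF p1] by blast
    then show "y \<in> carrier (U_pow p d)" by (simp add: i power_mod)
  next
    fix y assume "y \<in> carrier (U_pow p d)"
    then obtain i where i: "y = (g ^ i) ^ d mod p"
      unfolding carrier_U_pow[OF p1] tot by (auto simp: power_mod)
    have "y = (g ^ (i mod m)) ^ d mod p" unfolding i eq_iff by (simp add: cong_def)
    then have "y = ?f (int (i mod m))" by simp
    moreover have "int (i mod m) \<in> {0..<int m}" using km by simp
    ultimately show "y \<in> ?f ` {0..<int m}" by blast
  qed
  have "?f \<in> iso (integer_mod_group m) (U_pow p d)"
  proof (rule isoI)
    show "?f \<in> hom (integer_mod_group m) (U_pow p d)"
    proof (rule homI)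
      show "?f i \<in> carrier (U_pow p d)" if "i \<in> carrier (integer_mod_group m)" for i
        using that img car by blast
      fix i j assume "i \<in> carrier (integer_mod_group m)" "j \<in> carrier (integer_mod_group m)"
      then have ij: "0 \<le> i" "0 \<le> j" by (auto simp: car)
      have "nat ((i + j) mod int m) = (nat i + nat j) mod m"
        using ij by (simp add: nat_mod_distrib nat_add_distrib)
      then have "?f ((i + j) mod int m) = (g ^ (nat i + nat j)) ^ d mod p"
        unfolding eq_iff by (simp add: cong_def)
      also have "\<dots> = ?f i * ?f j mod p"
        by (simp add: power_add power_mult_distrib mod_mult_eq)
      finally show "?f (i \<otimes>\<^bsub>integer_mod_group m\<^esub> j) = ?f i \<otimes>\<^bsub>U_pow p d\<^esub> ?f j"
        using p1 by (simp add: mult_U_pow)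
    qed
    have "inj_on ?f {0..<int m}"
    proof (rule inj_onI)
      fix i j assume ij: "i \<in> {0..<int m}" "j \<in> {0..<int m}" "?f i = ?f j"
      then have "[nat i = nat j] (mod m)" unfolding eq_iff by simp
      moreover have "nat i < m" "nat j < m" using ij by auto
      ultimately have "nat i = nat j" by (simp add: cong_def)
      then show "i = j" using ij by (simp add: eq_nat_nat_iff)
    qed
    with img show "bij_betw ?f (carrier (integer_mod_group m)) (carrier (U_pow p d))"
      by (simp add: car bij_betw_def)
  qed
  then show ?thesis by (rule is_isoI)
qed

section \<open>Realising a finite abelian group\<close>

text \<open>
  A prime \<open>p\<close> congruent to \<open>1 + m * N\<close> modulo \<open>m * N\<^sup>2\<close> satisfies \<open>p - 1 = N * (1 + N * q) * m\<close> for some \<open>q\<close>. The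
  bound \<open>B\<close> keeps the primes chosen for different factors apart.
\<close>

lemma ex_prime_with_split_totient:
  fixes m N B :: nat
  assumes m: "m > 0" and N: "N > 0"
  obtains p t where "prime p" "p > B" "p - 1 = N * t * m" "t > 0" "coprime t N"
proof -
  let ?M = "m * N * N"
  have "coprime (m * N + 1) (m * N)" by (metis Suc_eq_plus1 coprime_Suc_left_nat)
  then have "coprime (m * N + 1) ?M" unfolding coprime_mult_right_iff by blast
  then have "infinite {p. prime p \<and> [p = m * N + 1] (mod ?M)}"
    using m N by (intro dirichlet_primes_in_progression) auto
  then obtain p where p: "p > B + (m * N + 1)" "prime p" "[p = m * N + 1] (mod ?M)"
    unfolding infinite_nat_iff_unbounded by blast
  then obtain q where q: "p = q * ?M + (m * N + 1)" using cong_le_nat[of "m * N + 1" p ?M] by auto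
  have "p - 1 = N * (1 + N * q) * m" by (simp add: q algebra_simps)
  moreover have "coprime (1 + N * q) (N * q)" by (metis plus_1_eq_Suc coprime_Suc_left_nat)
  then have "coprime (1 + N * q) N" unfolding coprime_mult_right_iff by blast
  ultimately show ?thesis using that[of p "1 + N * q"] p by simp
qed

text \<open>
  The exponent is not fixed in advance: each new cyclic factor brings its own prime \<open>p\<close> and cofactor \<open>t\<close>
  of \<open>p - 1\<close>, and the factors found earlier must survive the enlarged exponent. Hence the
  statement for all \<open>N * T\<close> with \<open>T\<close> a multiple of \<open>t\<close> coprime to \<open>N\<close>. The number \<open>N\<close> is
  an arbitrary common exponent, so that it can stay the same in the induction when the group is replaced
  by a complement of a cyclic factor. Starting with modulus \<open>2\<close> for the trivial group keeps all moduli above \<open>1\<close>,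
  where the residues are the usual ones.
\<close>

lemma ex_U_pow_iso:
  fixes G :: "('a, 'b) monoid_scheme"
  assumes N: "N > 0"
  shows "comm_group G \<Longrightarrow> finite (carrier G) \<Longrightarrow> (\<And>x. x \<in> carrier G \<Longrightarrow> x [^]\<^bsub>G\<^esub> N = \<one>\<^bsub>G\<^esub>) \<Longrightarrow>
    \<exists>n t. n > 1 \<and> t > 0 \<and> coprime t N \<and> (\<forall>T. t dvd T \<longrightarrow> coprime T N \<longrightarrow> G \<cong> U_pow n (N * T))"
proof (induction "card (carrier G)" arbitrary: G rule: less_induct)
  case less
  interpret G: comm_group G by (rule less.prems)
  note fin = less.prems(2)
  obtain g where g: "g \<in> carrier G" "\<And>y. y \<in> carrier G \<Longrightarrow> G.ord y dvd G.ord g"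
    using G.ex_ord_eq_exponent[OF fin] by blast
  define m where "m = G.ord g"
  have m0: "m > 0" using G.ord_ge_1[OF fin g(1)] by (simp add: m_def)
  show ?case
  proof (cases "m = 1")
    case True
    have "y = \<one>\<^bsub>G\<^esub>" if "y \<in> carrier G" for y
      using g(2)[OF that] True G.ord_eq_1[OF that] by (simp add: m_def)
    then have G: "carrier G = {\<one>\<^bsub>G\<^esub>}" by auto
    have "G \<cong> U_pow 2 (N * T)" for T
    proof -
      interpret P: comm_group "U_pow 2 (N * T)" by (rule comm_group_U_pow) simp
      have "totatives 2 = {1}" by (auto simp: totatives_def) presburger
      then have "carrier (U_pow 2 (N * T)) = {1}" by (simp add: carrier_U_pow)
      then have P: "carrier (U_pow 2 (N * T)) = {\<one>\<^bsub>U_pow 2 (N * T)\<^esub>}" using P.one_closed by auto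
      have "(\<lambda>_. \<one>\<^bsub>U_pow 2 (N * T)\<^esub>) \<in> iso G (U_pow 2 (N * T))"
        by (rule isoI) (auto simp: hom_def bij_betw_def G P)
      then show ?thesis by (rule is_isoI)
    qed
    then show ?thesis by (intro exI[of _ 2] exI[of _ 1]) simp
  next
    case False
    then have m1: "m > 1" using m0 by simp
    have mN: "m dvd N" using less.prems(3)[OF g(1)] G.pow_eq_id[OF g(1)] by (simp add: m_def)
    obtain K where K: "subgroup K G" "integer_mod_group m \<times>\<times> G\<lparr>carrier := K\<rparr> \<cong> G"
      using G.cyclic_direct_factor[OF fin g] unfolding m_def .
    let ?K = "G\<lparr>carrier := K\<rparr>"
    have KG: "K \<subseteq> carrier G" using subgroup.subset[OF K(1)] .
    interpret K: group ?K by (rule G.subgroup_imp_group[OF K(1)])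
    have commK: "comm_group ?K"
      by (rule K.group_comm_groupI) (use KG in \<open>auto intro!: G.m_comm\<close>)
    have finK: "finite K" using KG fin finite_subset by blast
    have K0: "card K > 0" using finK K.one_closed by (auto simp: card_gt_0_iff)
    have "card (carrier G) = m * card K"
      using iso_same_card[OF K(2)] m0 by (simp add: carrier_integer_mod_group card_cartesian_product)
    then have "card (carrier ?K) < card (carrier G)" using m1 K0 by simp
    moreover have "x [^]\<^bsub>?K\<^esub> N = \<one>\<^bsub>?K\<^esub>" if "x \<in> carrier ?K" for x
    proof -
      have "x [^]\<^bsub>?K\<^esub> N = x [^]\<^bsub>G\<^esub> N" by (rule G.nat_pow_consistent[symmetric])
      then show ?thesis using less.prems(3)[of x] KG that by auto
    qed
    ultimately obtain n t where n: "n > 1" "t > 0" "coprime t N"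
      and iso: "\<And>T. t dvd T \<Longrightarrow> coprime T N \<Longrightarrow> ?K \<cong> U_pow n (N * T)"
      using less.hyps[of ?K, OF _ commK] finK by auto
    obtain p u where p: "prime p" "p > n" "p - 1 = N * u * m" "u > 0" "coprime u N"
      using ex_prime_with_split_totient[OF m0 N] .
    have p1: "p > 1" using prime_gt_1_nat[OF p(1)] .
    have pn: "coprime p n"
      using p(1,2) n(1) by (intro prime_imp_coprime) (auto dest!: dvd_imp_le)
    have "G \<cong> U_pow (p * n) (N * T)" if T: "u * t dvd T" "coprime T N" for T
    proof -
      have uT: "u dvd T" using T(1) by (rule dvd_mult_left)
      then have d: "N * T = N * u * (T div u)" by (simp add: mult.assoc)
      have "T div u dvd T" using uT by (metis dvd_div_mult_self dvd_triv_left)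
      then have "coprime (T div u) m" using T(2) mN by (meson coprime_divisors)
      then have "integer_mod_group m \<cong> U_pow p (N * T)"
        using U_pow_prime_iso_cyclic[OF p(1,3) d] by blast
      moreover have "?K \<cong> U_pow n (N * T)" using iso T by (metis dvd_mult_right)
      ultimately have factors: "integer_mod_group m \<times>\<times> ?K \<cong> U_pow p (N * T) \<times>\<times> U_pow n (N * T)"
        unfolding is_iso_def using iso_paired2[OF group_integer_mod_group K.is_group] by blast
      have split: "G \<cong> integer_mod_group m \<times>\<times> ?K"
        by (rule group.iso_sym[OF DirProd_group[OF group_integer_mod_group K.is_group] K(2)])
      have "U_pow p (N * T) \<times>\<times> U_pow n (N * T) \<cong> U_pow (p * n) (N * T)"
      proof (rule group.iso_sym[OF _ U_pow_coprime_mult_iso[OF p1 n(1) pn]])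
        show "group (U_pow (p * n) (N * T))"
          using comm_group_U_pow[of "p * n"] p1 n(1) by (simp add: comm_group_def)
      qed
      then show ?thesis by (rule iso_trans[OF iso_trans[OF split factors]])
    qed
    moreover have "p * n > 1" by (rule less_1_mult[OF p1 n(1)])
    moreover have "u * t > 0" "coprime (u * t) N" using p n by auto
    ultimately show ?thesis by blast
  qed
qed

text \<open>
  The order of the group serves as common exponent \<open>N\<close>, and \<open>T = t\<close> as multiple of \<open>t\<close>.
\<close>

theorem theorem1:
  fixes G :: "('a, 'b) monoid_scheme"
  assumes "comm_group G" and "finite (carrier G)"
  shows "\<exists>n d :: nat. n > 0 \<and> d > 0 \<and> G \<cong> U_pow n d"
proof -
  interpret comm_group G by (rule assms)
  have N: "order G > 0" using assms(2) by (simp add: order_gt_0_iff_finite)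
  obtain n t where "n > 1" "t > 0" "coprime t (order G)"
      "\<forall>T. t dvd T \<longrightarrow> coprime T (order G) \<longrightarrow> G \<cong> U_pow n (order G * T)"
    using ex_U_pow_iso[OF N assms] pow_order_eq_1 by blast
  then show ?thesis using N by (intro exI[of _ n] exI[of _ "order G * t"]) simp
qed

end
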